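(* Consider the XOR Gaussian mixture data model with two-layer network and the empirical test risk described in the context, with $\widetilde M=\alpha d$. For every $L>0$ there are constants $c=c(K,L)>0$ and $C=C(K,L)$ such that for all $t>0$, $$\sup_{\|(v,W)\|\le L,\ W\in\mathcal W_0^c}\mathbb P\big(\|\nabla^2\widehat R(v,W)-\mathbb E[\nabla^2\widehat R(v,W)]\|_{op}>t\big)\le\exp\{-[c\alpha(t\wedge t^2)-C]d\},$$ and $$\sup_{\|(v,W)\|\le L}\mathbb P\big(\|\widehat G(v,W)-\mathbb E[\widehat G(v,W)]\|_{op}>t\big)\le\exp\{-[c\alpha(t\wedge t^2)-C]d\}.$$
   Context: Let $\mu,\nu\in\mathbb R^d$ be orthonormal and $\lambda\ge1$. A data point is $\mathbf Y=(y,Y)$ with $y\in\{0,1\}$ uniform; given $y=1$, $Y\sim\frac12\mathcal N(\mu,I_d/\lambda)+\frac12\mathcal N(-\mu,I_d/\lambda)$; given $y=0$, $Y\sim\frac12\mathcal N(\nu,I_d/\lambda)+\frac12\mathcal N(-\nu,I_d/\lambda)$. Fix width $K$; parameters $(v,W)$, $W\in\mathbb R^{K\times d}$ with rows $W_i$, $v\in\mathbb R^K$; $g(t)=\max(t,0)$ entrywise; loss $L((v,W),\mathbf Y)=-y\,v\cdot g(WY)+\log(1+e^{v\cdot g(WY)})$. Given i.i.d. samples $\widetilde{\mathbf Y}^1,\dots,\widetilde{\mathbf Y}^{\widetilde M}$, $\widehat R=\frac1{\widetilde M}\sum_\ell L(\cdot,\widetilde{\mathbf Y}^\ell)$ and $\widehat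 G=\frac1{\widetilde M}\sum_\ell\nabla L(\cdot,\widetilde{\mathbf Y}^\ell)^{\otimes2}$. $\mathcal W_0^c$ is the set of $W$ with $W_i\ne0$ for all $i$; for such $W$, almost surely no $W_i\cdot\widetilde Y^\ell$ vanishes, so $\widehat R$ is twice differentiable at $(v,W)$ and $\nabla^2\widehat R(v,W)$ is its (almost surely defined) Hessian, whose expectation appears above. *)

theory Defs
  imports "HOL-Probability.Probability"
begin

text \<open>Parameters (v,W) of the width-K network on R^d are encoded as a function
  theta on the index type nat + nat*nat: theta (Inl i) = v_i and
  theta (Inr (i,j)) = W_ij, for i < K, j < d. Vectors in R^d are functions
  nat => real read on {..<d}.\<close>

definition par_idx :: "nat \<Rightarrow> nat \<Rightarrow> (nat + nat \<times> nat) set" where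
  "par_idx K d = Inl ` {..<K} \<union> Inr ` ({..<K} \<times> {..<d})"

definition par_norm :: "nat \<Rightarrow> nat \<Rightarrow> (nat + nat \<times> nat \<Rightarrow> real) \<Rightarrow> real" where
  "par_norm K d \<theta> = sqrt (\<Sum>a\<in>par_idx K d. (\<theta> a)\<^sup>2)"

definition rows_nonzero :: "nat \<Rightarrow> nat \<Rightarrow> (nat + nat \<times> nat \<Rightarrow> real) \<Rightarrow> bool" where
  "rows_nonzero K d \<theta> \<longleftrightarrow> (\<forall>i<K. \<exists>j<d. \<theta> (Inr (i, j)) \<noteq> 0)"

definition relu :: "real \<Rightarrow> real" where
  "relu t = max t 0"

definition net :: "nat \<Rightarrow> nat \<Rightarrow> (nat + nat \<times> nat \<Rightarrow> real) \<Rightarrow> (nat \<Rightarrow> real) \<Rightarrow> real" where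
  "net K d \<theta> Y = (\<Sum>i<K. \<theta> (Inl i) * relu (\<Sum>j<d. \<theta> (Inr (i, j)) * Y j))"

definition loss :: "nat \<Rightarrow> nat \<Rightarrow> (nat + nat \<times> nat \<Rightarrow> real) \<Rightarrow> real \<times> (nat \<Rightarrow> real) \<Rightarrow> real" where
  "loss K d \<theta> yY = - fst yY * net K d \<theta> (snd yY) + ln (1 + exp (net K d \<theta> (snd yY)))"

text \<open>Partial derivative in coordinate a (convention 0 where the coordinate
  function is not differentiable, i.e. g'(0) = 0 for the ReLU).\<close>
definition pd :: "(('i \<Rightarrow> real) \<Rightarrow> real) \<Rightarrow> 'i \<Rightarrow> ('i \<Rightarrow> real) \<Rightarrow> real" where
  "pd f a \<theta> = (if (\<lambda>s. f (\<theta>(a := s))) differentiable (at (\<theta> a))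
                then deriv (\<lambda>s. f (\<theta>(a := s))) (\<theta> a) else 0)"

definition hess :: "(('i \<Rightarrow> real) \<Rightarrow> real) \<Rightarrow> ('i \<Rightarrow> real) \<Rightarrow> 'i \<Rightarrow> 'i \<Rightarrow> real" where
  "hess f \<theta> a b = pd (\<lambda>\<theta>'. pd f b \<theta>') a \<theta>"

definition op_norm :: "'i set \<Rightarrow> ('i \<Rightarrow> 'i \<Rightarrow> real) \<Rightarrow> real" where
  "op_norm P A = (SUP x\<in>{x. (\<Sum>b\<in>P. (x b)\<^sup>2) \<le> 1}. sqrt (\<Sum>a\<in>P. (\<Sum>b\<in>P. A a b * x b)\<^sup>2))"

text \<open>One data point is generated from (b, s, Z): label y = 1 iff b,
  sign s, and Z ~ N(0, I_d/lambda). Then Y = (+-1) * (mu or nu) + Z,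
  which has exactly the mixture law of the context.\<close>
definition point_law :: "nat \<Rightarrow> real \<Rightarrow> (bool \<times> bool \<times> (nat \<Rightarrow> real)) measure" where
  "point_law d lam = measure_pmf (pmf_of_set UNIV) \<Otimes>\<^sub>M (measure_pmf (pmf_of_set UNIV) \<Otimes>\<^sub>M
      PiM {..<d} (\<lambda>_. density lborel (normal_density 0 (1 / sqrt lam))))"

definition data_point :: "nat \<Rightarrow> (nat \<Rightarrow> real) \<Rightarrow> (nat \<Rightarrow> real) \<Rightarrow> bool \<times> bool \<times> (nat \<Rightarrow> real)
    \<Rightarrow> real \<times> (nat \<Rightarrow> real)" where
  "data_point d \<mu> \<nu> \<omega> = (case \<omega> of (b, s, Z) \<Rightarrow>
     (if b then 1 else 0,
      \<lambda>j. (if s then 1 else -1) * (if b then \<mu> j else \<nu> j) + Z j))"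

definition sample_space :: "nat \<Rightarrow> nat \<Rightarrow> real \<Rightarrow> (nat \<Rightarrow> bool \<times> bool \<times> (nat \<Rightarrow> real)) measure" where
  "sample_space d M lam = PiM {..<M} (\<lambda>_. point_law d lam)"

definition emp_risk :: "nat \<Rightarrow> nat \<Rightarrow> nat \<Rightarrow> (nat \<Rightarrow> real) \<Rightarrow> (nat \<Rightarrow> real)
    \<Rightarrow> (nat \<Rightarrow> bool \<times> bool \<times> (nat \<Rightarrow> real)) \<Rightarrow> (nat + nat \<times> nat \<Rightarrow> real) \<Rightarrow> real" where
  "emp_risk K d M \<mu> \<nu> \<omega> \<theta> = (\<Sum>l<M. loss K d \<theta> (data_point d \<mu> \<nu> (\<omega> l))) / real M"

definition emp_hess where
  "emp_hess K d M \<mu> \<nu> \<omega> \<theta> = hess (emp_risk K d M \<mu> \<nu> \<omega>) \<theta>"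

definition emp_G :: "nat \<Rightarrow> nat \<Rightarrow> nat \<Rightarrow> (nat \<Rightarrow> real) \<Rightarrow> (nat \<Rightarrow> real)
    \<Rightarrow> (nat \<Rightarrow> bool \<times> bool \<times> (nat \<Rightarrow> real)) \<Rightarrow> (nat + nat \<times> nat \<Rightarrow> real)
    \<Rightarrow> (nat + nat \<times> nat) \<Rightarrow> (nat + nat \<times> nat) \<Rightarrow> real" where
  "emp_G K d M \<mu> \<nu> \<omega> \<theta> a b =
     (\<Sum>l<M. pd (\<lambda>\<theta>'. loss K d \<theta>' (data_point d \<mu> \<nu> (\<omega> l))) a \<theta>
           * pd (\<lambda>\<theta>'. loss K d \<theta>' (data_point d \<mu> \<nu> (\<omega> l))) b \<theta>) / real M"

definition orthonormal2 :: "nat \<Rightarrow> (nat \<Rightarrow> real) \<Rightarrow> (nat \<Rightarrow> real) \<Rightarrow> bool" where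
  "orthonormal2 d \<mu> \<nu> \<longleftrightarrow> (\<Sum>j<d. (\<mu> j)\<^sup>2) = 1 \<and> (\<Sum>j<d. (\<nu> j)\<^sup>2) = 1 \<and> (\<Sum>j<d. \<mu> j * \<nu> j) = 0"

end

theory Submission
  imports Defs
begin

text \<open>For unit vectors x and y the bilinear forms of one summand of the empirical Hessian and of the
  empirical gradient matrix are bounded by a constant times 1 plus a sum of at most 3 K squares of
  projections of the data point onto vectors of norm at most 1. Each projection is Gaussian with bounded
  mean and variance, so the forms have an exponential moment that is uniform in the dimension, and
  Bernstein's inequality together with a union bound over a net of
  exponential cardinality in the unit ball controls the operator norm.

  The gradient formula with the convention g'(0) = 0 holds everywhere, but the Hessian formula
  holds only where no preactivation vanishes. As the integral of a non-measurable function is 0 in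
  Isabelle, the iterated partial derivative has to be shown Borel measurable also on the
  exceptional null set.\<close>

section \<open>Nets and operator norms\<close>

text \<open>The operator norm is an uncountable supremum, and its deviation event is never shown to
  be measurable. It is enclosed in a finite union of measurable events coming from the net, plus a
  null set, so the tail bounds are bounds for outer measures. The 3 K projections of one data point
  are dependent, so their joint exponential moment does not factor. It is bounded by single moments
  at 3 K times the exponent, a loss that depends on K only. Measurability of the Hessian is delicate
  because kinks of different samples can cancel: a partial derivative of the averaged loss is the
  common one-sided derivative wherever the two one-sided derivatives agree and 0 elsewhere, which
  need not be the average of the partial derivatives. On either side of a point of a coordinate line
  it switches between a continuous function and 0 along the zero set of another continuous function.
  Whether it is differentiable at the point quantifies over uncountably many parameters; compactness
  reduces this to countably many conditions.\<close>

lemma sum_half_power_abs: "(\<Sum>z=-int n..int n. (1/2::real) ^ nat \<bar>z\<bar>) = 3 - 2 * (1/2) ^ n"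
proof (induction n)
  case (Suc n)
  have "{-int (Suc n)..int (Suc n)} = insert (- int (Suc n)) (insert (int (Suc n)) {-int n..int n})"
    by auto
  then show ?case using Suc by (simp add: nat_add_distrib)
qed simp

text \<open>Counting by exponential weights: the product of
  \<open>2 ^ m * (1/2) ^ nat \<bar>f b\<bar>\<close> over \<open>P\<close> is at least 1 for each
  \<open>f\<close> in \<open>Z\<close>, so the cardinality is at most the total weight of the box,
  which factors over \<open>P\<close>. Each factor is \<open>2 ^ m\<close> times a two-sided
  geometric sum below 3, hence a bound uniform in the side \<open>n\<close> of the box.\<close>

lemma card_integer_l1_ball:
  fixes P :: "'i set" and m n :: nat
  assumes "finite P"
  defines "Z \<equiv> {f \<in> P \<rightarrow>\<^sub>E {-int n..int n}. (\<Sum>b\<in>P. \<bar>f b\<bar>) \<le> int (m * card P)}"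
  shows "finite Z" "real (card Z) \<le> (3 * 2 ^ m) ^ card P"
proof -
  let ?w = "\<lambda>z. 2 ^ m * (1/2::real) ^ nat \<bar>z\<bar>"
  have fin: "finite (P \<rightarrow>\<^sub>E {-int n..int n})" using assms by (simp add: finite_PiE)
  then show "finite Z" unfolding Z_def by simp
  have ge1: "1 \<le> (\<Prod>b\<in>P. ?w (f b))" if "f \<in> Z" for f
  proof -
    have "int (\<Sum>b\<in>P. nat \<bar>f b\<bar>) = (\<Sum>b\<in>P. \<bar>f b\<bar>)" by simp
    with that have *: "(\<Sum>b\<in>P. nat \<bar>f b\<bar>) \<le> m * card P"
      unfolding Z_def by (metis (no_types, lifting) mem_Collect_eq of_nat_le_iff)
    have "(\<Prod>b\<in>P. ?w (f b)) = 2 ^ (m * card P) * (1/2) ^ (\<Sum>b\<in>P. nat \<bar>f b\<bar>)"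
      by (simp add: prod.distrib power_sum power_mult)
    also have "\<dots> \<ge> 2 ^ (m * card P) * (1/2) ^ (m * card P)"
      using * by (intro mult_left_mono power_decreasing) auto
    finally show ?thesis by (simp add: power_mult_distrib[symmetric])
  qed
  have "real (card Z) = (\<Sum>f\<in>Z. 1)" by simp
  also have "\<dots> \<le> (\<Sum>f\<in>Z. \<Prod>b\<in>P. ?w (f b))" using ge1 by (intro sum_mono)
  also have "\<dots> \<le> (\<Sum>f\<in>P \<rightarrow>\<^sub>E {-int n..int n}. \<Prod>b\<in>P. ?w (f b))"
    using fin by (intro sum_mono2) (auto simp: Z_def intro!: prod_nonneg)
  also have "\<dots> = (\<Prod>b\<in>P. \<Sum>z=-int n..int n. ?w z)"
    using assms by (subst prod_sum_PiE) auto
  also have "\<dots> = (2 ^ m * (3 - 2 * (1/2) ^ n)) ^ card P"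
    by (simp add: sum_distrib_left[symmetric] sum_half_power_abs)
  also have "\<dots> \<le> (3 * 2 ^ m) ^ card P"
    using power_le_one[of "1/2::real" n] by (intro power_mono) auto
  finally show "real (card Z) \<le> (3 * 2 ^ m) ^ card P" .
qed

definition trunc :: "real \<Rightarrow> int" where
  "trunc y = (if 0 \<le> y then \<lfloor>y\<rfloor> else \<lceil>y\<rceil>)"

lemma abs_trunc_le: "\<bar>real_of_int (trunc y)\<bar> \<le> \<bar>y\<bar>"
proof (cases "0 \<le> y")
  case False
  then have "\<lceil>y\<rceil> \<le> 0" by (simp add: ceiling_le_iff)
  then have "real_of_int \<lceil>y\<rceil> \<le> 0" by simp
  with False show ?thesis unfolding trunc_def using le_of_int_ceiling[of y] by simp
qed (simp add: trunc_def)

lemma abs_diff_trunc: "\<bar>y - real_of_int (trunc y)\<bar> \<le> 1"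
  unfolding trunc_def by (auto simp: abs_if) linarith+

text \<open>The net is the part in the unit ball of the cubic grid of mesh 1/(4 sqrt (card P)); rounding
  towards 0 stays in the ball and moves a point by at most 1/4.\<close>

lemma unit_ball_net:
  fixes P :: "'i set"
  assumes "finite P"
  obtains N :: "('i \<Rightarrow> real) set" where "finite N" "real (card N) \<le> (3 * 2 ^ 16) ^ card P"
    "\<And>z. z \<in> N \<Longrightarrow> (\<Sum>b\<in>P. (z b)\<^sup>2) \<le> 1"
    "\<And>x. (\<Sum>b\<in>P. (x b)\<^sup>2) \<le> 1 \<Longrightarrow> \<exists>z\<in>N. L2_set (\<lambda>b. x b - z b) P \<le> 1/4"
proof -
  define p where "p = card P"
  define q where "q = 4 * sqrt (real p)"
  \<comment> \<open>\<open>16 * p\<close> is \<open>q\<^sup>2\<close>, the squared radius of the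
    unit ball in grid units. Integers satisfy |k| <= k^2, so the Euclidean bound also bounds the l1
    norm, and the counting lemma with m = 16 yields the base \<open>3 * 2 ^ 16\<close>.\<close>
  define Z where "Z = {f \<in> P \<rightarrow>\<^sub>E {-int (16 * p)..int (16 * p)}. (\<Sum>b\<in>P. \<bar>f b\<bar>) \<le> int (16 * p)}"
  define N where "N = (\<lambda>f b. real_of_int (f b) / q) ` {f \<in> Z. (\<Sum>b\<in>P. (f b)\<^sup>2) \<le> int (16 * p)}"
  have Z: "finite Z" "real (card Z) \<le> (3 * 2 ^ 16) ^ card P"
    unfolding Z_def p_def using card_integer_l1_ball[OF assms] by blast+
  have q2: "q\<^sup>2 = 16 * real p" by (simp add: q_def power_mult_distrib)
  have fN: "finite N" unfolding N_def using Z by simp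
  moreover have "real (card N) \<le> (3 * 2 ^ 16) ^ card P"
  proof -
    have "card N \<le> card {f \<in> Z. (\<Sum>b\<in>P. (f b)\<^sup>2) \<le> int (16 * p)}"
      unfolding N_def using Z by (intro card_image_le) auto
    also have "\<dots> \<le> card Z" using Z by (intro card_mono) auto
    finally show ?thesis using Z by linarith
  qed
  moreover have "(\<Sum>b\<in>P. (z b)\<^sup>2) \<le> 1" if "z \<in> N" for z
  proof -
    obtain f where f: "z = (\<lambda>b. real_of_int (f b) / q)" "(\<Sum>b\<in>P. (f b)\<^sup>2) \<le> int (16 * p)"
      using \<open>z \<in> N\<close> unfolding N_def by auto
    have "(\<Sum>b\<in>P. (z b)\<^sup>2) = real_of_int (\<Sum>b\<in>P. (f b)\<^sup>2) / (16 * real p)"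
      by (simp add: f(1) power_divide q2 sum_divide_distrib)
    also have "\<dots> \<le> 1"
    proof (cases "p = 0")
      case False
      have "real_of_int (\<Sum>b\<in>P. (f b)\<^sup>2) \<le> real_of_int (int (16 * p))"
        using f(2) of_int_le_iff by blast
      then show ?thesis using False by simp
    qed simp
    finally show ?thesis .
  qed
  moreover have "\<exists>z\<in>N. L2_set (\<lambda>b. x b - z b) P \<le> 1/4" if x: "(\<Sum>b\<in>P. (x b)\<^sup>2) \<le> 1" for x
  proof -
    define f where "f = restrict (\<lambda>b. trunc (q * x b)) P"
    have sq: "(\<Sum>b\<in>P. (f b)\<^sup>2) \<le> int (16 * p)"
    proof -
      have "real_of_int (\<Sum>b\<in>P. (f b)\<^sup>2) \<le> (\<Sum>b\<in>P. (q * x b)\<^sup>2)"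
        unfolding of_int_sum of_int_power
        by (intro sum_mono) (use abs_trunc_le in \<open>auto simp: f_def simp flip: abs_le_square_iff\<close>)
      also have "\<dots> = q\<^sup>2 * (\<Sum>b\<in>P. (x b)\<^sup>2)" by (simp add: power_mult_distrib sum_distrib_left)
      also have "\<dots> \<le> q\<^sup>2 * 1" using x by (intro mult_left_mono) auto
      finally have "real_of_int (\<Sum>b\<in>P. (f b)\<^sup>2) \<le> real_of_int (int (16 * p))" by (simp add: q2)
      then show ?thesis using of_int_le_iff by blast
    qed
    have le_sq: "\<bar>k\<bar> \<le> k\<^sup>2" for k :: int
    proof (cases "k = 0")
      case False
      then have "\<bar>k\<bar> * 1 \<le> \<bar>k\<bar> * \<bar>k\<bar>" by (intro mult_left_mono) auto
      then show ?thesis by (simp add: power2_eq_square)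
    qed simp
    have l1: "(\<Sum>b\<in>P. \<bar>f b\<bar>) \<le> int (16 * p)"
      using sum_mono[of P "\<lambda>b. \<bar>f b\<bar>" "\<lambda>b. (f b)\<^sup>2"] le_sq sq by force
    have "\<bar>f b\<bar> \<le> int (16 * p)" if "b \<in> P" for b
      using l1 member_le_sum[of b P "\<lambda>b. \<bar>f b\<bar>"] that assms by simp
    then have "f \<in> P \<rightarrow>\<^sub>E {-int (16 * p)..int (16 * p)}"
      by (auto simp: PiE_iff f_def abs_le_iff minus_le_iff)
    with l1 sq have mem: "(\<lambda>b. real_of_int (f b) / q) \<in> N" unfolding N_def Z_def by blast
    have "L2_set (\<lambda>b. x b - real_of_int (f b) / q) P \<le> 1/4"
    proof (cases "p = 0")
      case True
      then have "P = {}" using assms p_def by simp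
      then show ?thesis by simp
    next
      case False
      then have q: "q > 0" by (simp add: q_def)
      have "(x b - real_of_int (f b) / q)\<^sup>2 \<le> 1 / q\<^sup>2" if "b \<in> P" for b
      proof -
        have "x b - real_of_int (f b) / q = (q * x b - real_of_int (trunc (q * x b))) / q"
          using q that by (simp add: f_def field_simps)
        then have "\<bar>x b - real_of_int (f b) / q\<bar> = \<bar>q * x b - real_of_int (trunc (q * x b))\<bar> / q"
          using q by (simp add: abs_divide)
        also have "\<dots> \<le> 1 / q" using abs_diff_trunc q by (intro divide_right_mono) auto
        finally show ?thesis using q by (metis abs_le_square_iff abs_of_pos power_one_over zero_less_divide_1_iff)
      qed
      then have "(\<Sum>b\<in>P. (x b - real_of_int (f b) / q)\<^sup>2) \<le> (\<Sum>b\<in>P. 1 / q\<^sup>2)"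
        by (rule sum_mono)
      also have "\<dots> = 1/16" using False by (simp add: q2 p_def)
      finally have "(\<Sum>b\<in>P. (x b - real_of_int (f b) / q)\<^sup>2) \<le> (1/4)\<^sup>2"
        by (simp add: power2_eq_square)
      then show ?thesis unfolding L2_set_def by (intro real_le_lsqrt) (auto intro: sum_nonneg)
    qed
    then show ?thesis by (intro bexI[OF _ mem])
  qed
  ultimately show ?thesis using that by blast
qed

text \<open>\<open>op_norm\<close> is a supremum of reals, hence under control only once its set is
  known to be bounded. Cauchy-Schwarz in each row gives the Frobenius norm as a bound.\<close>

lemma bdd_above_op_norm:
  fixes A :: "'i \<Rightarrow> 'i \<Rightarrow> real"
  assumes "finite P"
  shows "bdd_above ((\<lambda>x. L2_set (\<lambda>a. \<Sum>b\<in>P. A a b * x b) P) ` {x. (\<Sum>b\<in>P. (x b)\<^sup>2) \<le> 1})"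
proof (intro bdd_aboveI2)
  fix x :: "'i \<Rightarrow> real"
  assume "x \<in> {x. (\<Sum>b\<in>P. (x b)\<^sup>2) \<le> 1}"
  then have x: "L2_set x P \<le> 1" by (simp add: L2_set_def)
  have "\<bar>\<Sum>b\<in>P. A a b * x b\<bar> \<le> L2_set (A a) P" for a
  proof -
    have "\<bar>\<Sum>b\<in>P. A a b * x b\<bar> \<le> (\<Sum>b\<in>P. \<bar>A a b\<bar> * \<bar>x b\<bar>)"
      by (rule order_trans[OF sum_abs]) (simp add: abs_mult)
    also have "\<dots> \<le> L2_set (A a) P * L2_set x P" by (rule L2_set_mult_ineq)
    also have "\<dots> \<le> L2_set (A a) P * 1" using x by (intro mult_left_mono) (auto intro: L2_set_nonneg)
    finally show ?thesis by simp
  qed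
  then have "L2_set (\<lambda>a. \<bar>\<Sum>b\<in>P. A a b * x b\<bar>) P \<le> L2_set (\<lambda>a. L2_set (A a) P) P"
    by (intro L2_set_mono) auto
  then show "L2_set (\<lambda>a. \<Sum>b\<in>P. A a b * x b) P \<le> L2_set (\<lambda>a. L2_set (A a) P) P"
    by (simp add: L2_set_def)
qed

text \<open>\<open>A\<close> is an arbitrary matrix, so two net points occur: \<open>y\<close>
  replaces the argument and \<open>x\<close> the normalized direction of its image. If all forms on
  the net are at most t/2, then |A y| <= t/2 + |A y| / 4 for \<open>y\<close> in the net, so |A y|
  <= 2 t / 3. Approximating an arbitrary argument gives B <= 2 t / 3 + B / 4 for the norm B, that is
  B <= 8 t / 9 < t.\<close>

lemma op_norm_gt_net:
  assumes "finite P" "0 < t" "t < op_norm P A"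
    and N: "\<And>x. (\<Sum>b\<in>P. (x b)\<^sup>2) \<le> 1 \<Longrightarrow> \<exists>z\<in>N. L2_set (\<lambda>b. x b - z b) P \<le> 1/4"
      "\<And>z. z \<in> N \<Longrightarrow> (\<Sum>b\<in>P. (z b)\<^sup>2) \<le> 1"
  shows "\<exists>x\<in>N. \<exists>y\<in>N. t / 2 < (\<Sum>a\<in>P. \<Sum>b\<in>P. x a * A a b * y b)"
proof (rule ccontr)
  assume "\<not> ?thesis"
  then have le: "(\<Sum>a\<in>P. x a * (\<Sum>b\<in>P. A a b * y b)) \<le> t / 2" if "x \<in> N" "y \<in> N" for x y
    using that by (auto simp: not_less sum_distrib_left mult.assoc)
  define B where "B = op_norm P A"
  let ?n = "\<lambda>x. L2_set (\<lambda>a. \<Sum>b\<in>P. A a b * x b) P"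
  have B_eq: "B = (SUP x\<in>{x. (\<Sum>b\<in>P. (x b)\<^sup>2) \<le> 1}. ?n x)"
    unfolding B_def op_norm_def L2_set_def by simp
  have leB: "?n x \<le> B" if "(\<Sum>b\<in>P. (x b)\<^sup>2) \<le> 1" for x
    unfolding B_eq using that bdd_above_op_norm[OF assms(1)] by (intro cSUP_upper) auto
  have small: "?n x \<le> B / 4" if "L2_set x P \<le> 1/4" for x
  proof -
    have "L2_set (\<lambda>b. 4 * x b) P \<le> 1"
      using that by (subst L2_set_right_distrib[symmetric]) auto
    then have "(\<Sum>b\<in>P. (4 * x b)\<^sup>2) \<le> 1" by (simp add: L2_set_def)
    from leB[OF this] have "L2_set (\<lambda>a. 4 * (\<Sum>b\<in>P. A a b * x b)) P \<le> B"
      by (simp add: sum_distrib_left mult.left_commute)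
    then show ?thesis by (simp add: L2_set_right_distrib[symmetric])
  qed
  have net: "?n y \<le> 2 * t / 3" if y: "y \<in> N" for y
  proof (cases "?n y = 0")
    case False
    define c where "c = (\<lambda>a. \<Sum>b\<in>P. A a b * y b)"
    define n where "n = ?n y"
    have n: "n > 0" "n = L2_set c P"
      using False L2_set_nonneg[of c P] unfolding n_def c_def by linarith+
    have ncc: "(\<Sum>a\<in>P. c a * c a) = n * n" using n
      by (simp add: L2_set_def power2_eq_square[symmetric] sum_nonneg)
    have "(\<Sum>a\<in>P. (c a / n)\<^sup>2) = 1"
      using n ncc by (simp add: power_divide power2_eq_square sum_divide_distrib[symmetric])
    then obtain x where x: "x \<in> N" "L2_set (\<lambda>a. c a / n - x a) P \<le> 1/4"
      using N(1)[of "\<lambda>a. c a / n"] by auto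
    have "n = (\<Sum>a\<in>P. c a / n * c a)"
      using n ncc by (simp add: sum_divide_distrib[symmetric])
    also have "\<dots> = (\<Sum>a\<in>P. x a * c a) + (\<Sum>a\<in>P. (c a / n - x a) * c a)"
      by (simp add: sum.distrib[symmetric] algebra_simps)
    also have "\<dots> \<le> t / 2 + L2_set (\<lambda>a. c a / n - x a) P * L2_set c P"
    proof (intro add_mono)
      show "(\<Sum>a\<in>P. x a * c a) \<le> t / 2" using le[OF x(1) y] by (simp add: c_def)
      have "(\<Sum>a\<in>P. (c a / n - x a) * c a) \<le> (\<Sum>a\<in>P. \<bar>c a / n - x a\<bar> * \<bar>c a\<bar>)"
        by (intro sum_mono) (metis abs_ge_self abs_mult)
      also have "\<dots> \<le> L2_set (\<lambda>a. c a / n - x a) P * L2_set c P" by (rule L2_set_mult_ineq)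
      finally show "(\<Sum>a\<in>P. (c a / n - x a) * c a) \<le> L2_set (\<lambda>a. c a / n - x a) P * L2_set c P" .
    qed
    also have "\<dots> \<le> t / 2 + 1/4 * n"
      unfolding n(2)[symmetric] using x(2) n by (intro add_left_mono mult_right_mono) auto
    finally show ?thesis unfolding n_def by linarith
  qed (use \<open>0 < t\<close> in simp)
  have "?n y \<le> 2 * t / 3 + B / 4" if y: "(\<Sum>b\<in>P. (y b)\<^sup>2) \<le> 1" for y
  proof -
    obtain z where z: "z \<in> N" "L2_set (\<lambda>b. y b - z b) P \<le> 1/4" using N(1)[OF y] by auto
    have "?n y = L2_set (\<lambda>a. (\<Sum>b\<in>P. A a b * z b) + (\<Sum>b\<in>P. A a b * (y b - z b))) P"
      by (simp add: sum.distrib[symmetric] algebra_simps)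
    also have "\<dots> \<le> ?n z + ?n (\<lambda>b. y b - z b)" by (rule L2_set_triangle_ineq)
    also have "\<dots> \<le> 2 * t / 3 + B / 4" using net[OF z(1)] small[OF z(2)] by (rule add_mono)
    finally show ?thesis .
  qed
  then have "B \<le> 2 * t / 3 + B / 4"
    unfolding B_eq by (intro cSUP_least) (auto intro!: exI[of _ "\<lambda>_. 0"])
  with assms(2,3) show False unfolding B_def by linarith
qed

section \<open>Bernstein bounds for means of random matrices\<close>

lemma exp_le_quadratic: "exp x \<le> 1 + x + x\<^sup>2 / 2 * exp \<bar>x\<bar>" for x :: real
proof -
  obtain t where t: "\<bar>t\<bar> \<le> \<bar>x\<bar>" "exp x = (\<Sum>m<2. x ^ m / fact m) + exp t / fact 2 * x ^ 2"
    using Maclaurin_exp_le[of x 2] by blast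
  have "exp t \<le> exp \<bar>x\<bar>" using t(1) by simp
  then have "x\<^sup>2 / 2 * exp t \<le> x\<^sup>2 / 2 * exp \<bar>x\<bar>" by (intro mult_left_mono) auto
  then show ?thesis using t(2) by (simp add: numeral_2_eq_2 mult.commute)
qed

context prob_space
begin

text \<open>Exponential moments are stated as nonnegative integrals, so that a finite bound already
  contains integrability. The first moment follows from |x| <= exp (s0 |x|) / s0.\<close>

lemma integrable_of_exp_moment:
  assumes [measurable]: "X \<in> borel_measurable M" and "0 < s0"
    and B: "(\<integral>\<^sup>+\<omega>. ennreal (exp (s0 * \<bar>X \<omega>\<bar>)) \<partial>M) \<le> ennreal B"
  shows "integrable M (\<lambda>\<omega>. exp (s0 * \<bar>X \<omega>\<bar>))" "integrable M X"
proof -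
  show e: "integrable M (\<lambda>\<omega>. exp (s0 * \<bar>X \<omega>\<bar>))"
    using le_less_trans[OF B ennreal_less_top] by (intro integrableI_bounded) auto
  show "integrable M X"
  proof (rule Bochner_Integration.integrable_bound)
    show "integrable M (\<lambda>\<omega>. exp (s0 * \<bar>X \<omega>\<bar>) / s0)" using e by simp
    have "\<bar>x\<bar> \<le> exp (s0 * \<bar>x\<bar>) / s0" for x
      using order_trans[OF _ exp_ge_add_one_self, of "s0 * \<bar>x\<bar>"] \<open>0 < s0\<close>
      by (simp add: field_simps)
    then show "AE \<omega> in M. norm (X \<omega>) \<le> norm (exp (s0 * \<bar>X \<omega>\<bar>) / s0)"
      using \<open>0 < s0\<close> by (auto intro!: order_trans[OF _ abs_ge_self])
  qed simp
qed

text \<open>Second-order expansion of the exponential; the remainder is absorbed by the other half of the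
  exponential moment.\<close>

lemma centered_mgf_le:
  assumes X[measurable]: "X \<in> borel_measurable M" and "0 < s0"
    and B: "(\<integral>\<^sup>+\<omega>. ennreal (exp (s0 * \<bar>X \<omega>\<bar>)) \<partial>M) \<le> ennreal B" "0 \<le> B"
    and s: "\<bar>s\<bar> \<le> s0 / 2"
  shows "(\<integral>\<^sup>+\<omega>. ennreal (exp (s * (X \<omega> - expectation X))) \<partial>M)
    \<le> ennreal (exp (4 * B * exp B / s0\<^sup>2 * s\<^sup>2))"
proof -
  let ?e = "\<lambda>\<omega>. exp (s0 * \<bar>X \<omega>\<bar>)"
  note int = integrable_of_exp_moment[OF X \<open>0 < s0\<close> B(1)]
  have EB: "expectation ?e \<le> B"
    using B int by (subst (asm) nn_integral_eq_integral) auto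
  have "\<bar>expectation X\<bar> \<le> expectation (\<lambda>\<omega>. \<bar>X \<omega>\<bar>)"
    using integral_norm_bound[of M X] by simp
  also have "\<dots> \<le> expectation (\<lambda>\<omega>. ?e \<omega> / s0)"
  proof (rule integral_mono)
    show "\<bar>X \<omega>\<bar> \<le> ?e \<omega> / s0" for \<omega>
      using order_trans[OF _ exp_ge_add_one_self, of "s0 * \<bar>X \<omega>\<bar>"] \<open>0 < s0\<close>
        by (simp add: field_simps)
  qed (use int in auto)
  also have "\<dots> \<le> B / s0" using EB \<open>0 < s0\<close> by (simp add: divide_right_mono)
  finally have mean: "s0 * \<bar>expectation X\<bar> \<le> B" using \<open>0 < s0\<close> by (simp add: field_simps)
  define c where "c = s\<^sup>2 * (4 / s0\<^sup>2 * exp B)"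
  have pw: "exp (s * (X \<omega> - expectation X)) \<le> 1 + s * (X \<omega> - expectation X) + c * ?e \<omega>" for \<omega>
  proof -
    define u where "u = \<bar>X \<omega> - expectation X\<bar>"
    have u: "0 \<le> u" "u\<^sup>2 = (X \<omega> - expectation X)\<^sup>2" by (auto simp: u_def)
    \<comment> \<open>Half of the exponent \<open>s0 * u\<close> absorbs \<open>u\<^sup>2\<close>,
      and the other half dominates \<open>exp (\<bar>s\<bar> * u)\<close>. Passing from
      \<open>u\<close> to \<open>\<bar>X \<omega>\<bar>\<close> afterwards costs the factor
      \<open>exp B\<close>, because s0 times the absolute mean is at most B.\<close>
    have "(s0 / 2 * u)\<^sup>2 \<le> 2 * exp (s0 / 2 * u)"
    proof -
      have "0 \<le> s0 / 2 * u" using u \<open>0 < s0\<close> by simp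
      with exp_lower_Taylor_quadratic[OF this] show ?thesis by linarith
    qed
    then have u2: "u\<^sup>2 \<le> 8 / s0\<^sup>2 * exp (s0 / 2 * u)"
      using \<open>0 < s0\<close> by (simp add: field_simps power2_eq_square)
    have "exp (\<bar>s\<bar> * u) \<le> exp (s0 / 2 * u)" using mult_right_mono[OF s u(1)] by simp
    with u2 have "u\<^sup>2 * exp (\<bar>s\<bar> * u) \<le> 8 / s0\<^sup>2 * exp (s0 / 2 * u) * exp (s0 / 2 * u)"
      by (intro mult_mono) auto
    also have "\<dots> = 8 / s0\<^sup>2 * exp (s0 * u)" by (simp add: exp_add[symmetric])
    also have "\<dots> \<le> 8 / s0\<^sup>2 * (exp B * ?e \<omega>)"
    proof (intro mult_left_mono)
      have "s0 * u \<le> s0 * (\<bar>X \<omega>\<bar> + \<bar>expectation X\<bar>)"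
        unfolding u_def using \<open>0 < s0\<close> by (intro mult_left_mono) auto
      also have "\<dots> \<le> B + s0 * \<bar>X \<omega>\<bar>" using mean by (simp add: distrib_left)
      finally show "exp (s0 * u) \<le> exp B * ?e \<omega>" by (simp add: exp_add[symmetric])
    qed simp
    finally have "s\<^sup>2 / 2 * (u\<^sup>2 * exp (\<bar>s\<bar> * u)) \<le> s\<^sup>2 / 2 * (8 / s0\<^sup>2 * (exp B * ?e \<omega>))"
      by (intro mult_left_mono) auto
    also have "\<dots> = c * ?e \<omega>" by (simp add: c_def)
    finally show ?thesis
      using exp_le_quadratic[of "s * (X \<omega> - expectation X)"]
      by (simp add: power_mult_distrib u abs_mult u_def[symmetric] mult.assoc)
  qed
  let ?r = "\<lambda>\<omega>. 1 + s * (X \<omega> - expectation X) + c * ?e \<omega>"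
  have intr: "integrable M ?r" using int by auto
  have "(\<integral>\<^sup>+\<omega>. ennreal (exp (s * (X \<omega> - expectation X))) \<partial>M) \<le> (\<integral>\<^sup>+\<omega>. ennreal (?r \<omega>) \<partial>M)"
    using pw by (intro nn_integral_mono) (simp add: ennreal_leI)
  also have "\<dots> = ennreal (expectation ?r)"
    by (rule nn_integral_eq_integral[OF intr]) (use pw exp_ge_zero order_trans in blast)
  also have "expectation ?r = 1 + c * expectation ?e"
    using int by (simp add: prob_space)
  also have "\<dots> \<le> 1 + c * B" using mult_left_mono[OF EB, of c] by (simp add: c_def)
  also have "\<dots> \<le> exp (c * B)" by (rule exp_ge_add_one_self)
  also have "c * B = 4 * B * exp B / s0\<^sup>2 * s\<^sup>2" by (simp add: c_def)
  finally show ?thesis by (simp add: ennreal_leI)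
qed

text \<open>Chernoff's method. An upper tail suffices, since a large operator norm produces a
  bilinear form on the net that is large with positive sign.\<close>

lemma iid_mean_tail:
  assumes X[measurable]: "X \<in> borel_measurable M" and "0 < s0"
    and B: "(\<integral>\<^sup>+\<omega>. ennreal (exp (s0 * \<bar>X \<omega>\<bar>)) \<partial>M) \<le> ennreal B" "0 < B"
    and "0 < u" "0 < n"
  shows "emeasure (Pi\<^sub>M {..<n} (\<lambda>_. M)) {\<omega> \<in> space (Pi\<^sub>M {..<n} (\<lambda>_. M)).
      u < (\<Sum>l<n. X (\<omega> l)) / real n - expectation X}
    \<le> ennreal (exp (- (min (s0\<^sup>2 / (16 * B * exp B)) (s0 / 4) * real n * min u (u\<^sup>2))))"
proof -
  interpret product_sigma_finite "\<lambda>_::nat. M" by unfold_locales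
  define V where "V = 4 * B * exp B / s0\<^sup>2"
  \<comment> \<open>\<open>u / (2 * V)\<close> minimizes \<open>V * s\<^sup>2 - s * u\<close>, and
    \<open>s0 / 2\<close> is the largest exponent with a controlled moment. The unconstrained
    minimizer gives the quadratic regime \<open>u\<^sup>2 / (4 * V)\<close>; at the cap,
    \<open>V * s0 \<le> u\<close> leaves the linear regime \<open>s0 * u / 4\<close>.\<close>
  define s where "s = min (s0 / 2) (u / (2 * V))"
  have V: "0 < V" using assms by (simp add: V_def)
  have s: "0 < s" "\<bar>s\<bar> \<le> s0 / 2" using V assms by (auto simp: s_def)
  let ?P = "Pi\<^sub>M {..<n} (\<lambda>_. M)"
  let ?A = "{\<omega> \<in> space ?P. u < (\<Sum>l<n. X (\<omega> l)) / real n - expectation X}"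
  let ?U = "\<lambda>x. X x - expectation X"
  have "emeasure ?P ?A = (\<integral>\<^sup>+\<omega>. indicator ?A \<omega> \<partial>?P)" by simp
  also have "\<dots> \<le> (\<integral>\<^sup>+\<omega>. ennreal (exp (- s * u * n)) * (\<Prod>l<n. ennreal (exp (s * ?U (\<omega> l)))) \<partial>?P)"
  proof (intro nn_integral_mono)
    fix \<omega>
    have "1 \<le> exp (- s * u * n) * (\<Prod>l<n. exp (s * ?U (\<omega> l)))" if "\<omega> \<in> ?A"
    proof -
      have "real n * u < (\<Sum>l<n. X (\<omega> l)) - n * expectation X"
        using that \<open>0 < n\<close> by (simp add: field_simps)
      also have "\<dots> = (\<Sum>l<n. ?U (\<omega> l))" by (simp add: sum_subtractf)
      finally have "s * (real n * u) \<le> s * (\<Sum>l<n. ?U (\<omega> l))"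
        using s by (intro mult_left_mono) auto
      then show ?thesis
        by (simp add: exp_sum[symmetric] exp_add[symmetric] sum_distrib_left[symmetric] mult_ac)
    qed
    then show "indicator ?A \<omega> \<le> ennreal (exp (- s * u * n)) * (\<Prod>l<n. ennreal (exp (s * ?U (\<omega> l))))"
      by (simp add: prod_ennreal ennreal_mult[symmetric] prod_nonneg indicator_def ennreal_leI
          flip: ennreal_1)
  qed
  also have "\<dots> = ennreal (exp (- s * u * n)) *
      (\<Prod>l<n. (\<integral>\<^sup>+x. ennreal (exp (s * ?U x)) \<partial>M))"
    by (subst nn_integral_cmult, measurable, subst product_nn_integral_prod) simp_all
  also have "\<dots> \<le> ennreal (exp (- s * u * n)) * (\<Prod>l<n. ennreal (exp (V * s\<^sup>2)))"
    unfolding V_def using centered_mgf_le[OF X \<open>0 < s0\<close> B(1) _ s(2)] B(2)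
    by (auto intro!: mult_left_mono power_mono)
  also have "\<dots> = ennreal (exp (real n * (V * s\<^sup>2 - s * u)))"
  proof -
    have "exp (- s * u * n) * (\<Prod>l<n. exp (V * s\<^sup>2)) = exp (real n * (V * s\<^sup>2 - s * u))"
      by (simp add: exp_of_nat_mult[symmetric] exp_add[symmetric] right_diff_distrib mult_ac)
    moreover have "(\<Prod>l<n. ennreal (exp (V * s\<^sup>2))) = ennreal (\<Prod>l<n. exp (V * s\<^sup>2))"
      by (rule prod_ennreal) simp
    ultimately show ?thesis by (metis ennreal_mult' exp_ge_zero)
  qed
  also have "\<dots> \<le> ennreal (exp (- (min (1 / (4 * V)) (s0 / 4) * real n * min u (u\<^sup>2))))"
  proof -
    define c where "c = min (1 / (4 * V)) (s0 / 4)"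
    have c: "0 \<le> c" using V \<open>0 < s0\<close> by (simp add: c_def)
    have "V * s\<^sup>2 - s * u \<le> - (c * min u (u\<^sup>2))"
    proof (cases "u / (2 * V) \<le> s0 / 2")
      case True
      then have "s = u / (2 * V)" by (simp add: s_def)
      then have "u = 2 * V * s" using V by simp
      then have "V * s\<^sup>2 - s * u = - (1 / (4 * V) * u\<^sup>2)"
        using V by (simp add: field_simps power2_eq_square)
      moreover have "c * min u (u\<^sup>2) \<le> 1 / (4 * V) * u\<^sup>2"
        using c V \<open>0 < u\<close> by (intro mult_mono) (auto simp: c_def)
      ultimately show ?thesis by linarith
    next
      case False
      then have "s = s0 / 2" "V * s0 \<le> u" using V by (auto simp: s_def field_simps)
      then have "s * (V * (2 * s)) \<le> s * u" "s0 = 2 * s"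
        using \<open>0 < s\<close> by (auto intro!: mult_left_mono)
      then have "V * s\<^sup>2 - s * u \<le> - (s0 / 4 * u)"
        by (simp add: power2_eq_square mult_ac)
      moreover have "c * min u (u\<^sup>2) \<le> s0 / 4 * u"
        using c \<open>0 < s0\<close> \<open>0 < u\<close> by (intro mult_mono) (auto simp: c_def)
      ultimately show ?thesis by linarith
    qed
    then have "real n * (V * s\<^sup>2 - s * u) \<le> real n * - (c * min u (u\<^sup>2))"
      by (intro mult_left_mono) auto
    then show ?thesis unfolding c_def by (intro ennreal_leI) (simp add: mult_ac)
  qed
  also have "1 / (4 * V) = s0\<^sup>2 / (16 * B * exp B)" by (simp add: V_def)
  finally show ?thesis .
qed

text \<open>An entry is the bilinear form at two coordinate vectors, so the uniform moment
  hypothesis covers it.\<close>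

lemma integrable_entry_of_exp_moment:
  fixes H :: "'a \<Rightarrow> 'i \<Rightarrow> 'i \<Rightarrow> real"
  assumes P: "finite P" and "0 < s0" and ab: "a \<in> P" "b \<in> P"
    and H: "(\<lambda>\<omega>. H \<omega> a b) \<in> borel_measurable M"
    and mom: "\<And>x y. (\<Sum>b\<in>P. (x b)\<^sup>2) \<le> 1 \<Longrightarrow> (\<Sum>b\<in>P. (y b)\<^sup>2) \<le> 1 \<Longrightarrow>
      (\<integral>\<^sup>+\<omega>. ennreal (exp (s0 * \<bar>\<Sum>a\<in>P. \<Sum>b\<in>P. x a * H \<omega> a b * y b\<bar>)) \<partial>M) \<le> ennreal B"
  shows "integrable M (\<lambda>\<omega>. H \<omega> a b)"
proof -
  let ?e = "\<lambda>a b. if b = a then 1 else 0 :: real"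
  have "(\<Sum>c\<in>P. (?e a c)\<^sup>2) = (\<Sum>c\<in>P. ?e a c)" for a by (intro sum.cong) auto
  then have "(\<Sum>c\<in>P. (?e a c)\<^sup>2) \<le> 1" if "a \<in> P" for a using P that by simp
  note moment = mom[OF this this, OF ab]
  have *: "(\<Sum>c\<in>P. \<Sum>d\<in>P. ?e a c * H \<omega> c d * ?e b d) = H \<omega> a b" for \<omega>
  proof -
    have "(\<Sum>c\<in>P. \<Sum>d\<in>P. ?e a c * H \<omega> c d * ?e b d) =
        (\<Sum>c\<in>P. if c = a then \<Sum>d\<in>P. if d = b then H \<omega> c d else 0 else 0)"
      by (intro sum.cong) (auto intro!: sum.cong sum.neutral)
    also have "\<dots> = H \<omega> a b" using P ab by simp
    finally show ?thesis .
  qed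
  from moment
  have "(\<integral>\<^sup>+\<omega>. ennreal (exp (s0 * \<bar>H \<omega> a b\<bar>)) \<partial>M) \<le> ennreal B"
    by (simp only: *)
  then show ?thesis by (rule integrable_of_exp_moment(2)[OF H \<open>0 < s0\<close>])
qed

text \<open>An exponential moment that is uniform over the bilinear forms with unit vectors suffices:
  union bound over pairs of points of the net.\<close>

lemma iid_matrix_mean_tail:
  fixes H :: "'a \<Rightarrow> 'i \<Rightarrow> 'i \<Rightarrow> real"
  assumes P: "finite P" and "0 < s0" "0 < B" "0 < t" "0 < n"
    and H[measurable]: "\<And>a b. a \<in> P \<Longrightarrow> b \<in> P \<Longrightarrow> (\<lambda>\<omega>. H \<omega> a b) \<in> borel_measurable M"
    and mom: "\<And>x y. (\<Sum>b\<in>P. (x b)\<^sup>2) \<le> 1 \<Longrightarrow> (\<Sum>b\<in>P. (y b)\<^sup>2) \<le> 1 \<Longrightarrow>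
      (\<integral>\<^sup>+\<omega>. ennreal (exp (s0 * \<bar>\<Sum>a\<in>P. \<Sum>b\<in>P. x a * H \<omega> a b * y b\<bar>)) \<partial>M) \<le> ennreal B"
  shows "\<exists>S\<in>sets (Pi\<^sub>M {..<n} (\<lambda>_. M)).
    {\<omega> \<in> space (Pi\<^sub>M {..<n} (\<lambda>_. M)).
       t < op_norm P (\<lambda>a b. (\<Sum>l<n. H (\<omega> l) a b) / real n - expectation (\<lambda>\<omega>. H \<omega> a b))} \<subseteq> S \<and>
    emeasure (Pi\<^sub>M {..<n} (\<lambda>_. M)) S \<le> ennreal ((3 * 2 ^ 16) ^ (2 * card P) *
      exp (- (min (s0\<^sup>2 / (16 * B * exp B)) (s0 / 4) / 4 * real n * min t (t\<^sup>2))))"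
proof -
  let ?P = "Pi\<^sub>M {..<n} (\<lambda>_. M)"
  have intH: "integrable M (\<lambda>\<omega>. H \<omega> a b)" if "a \<in> P" "b \<in> P" for a b
    by (rule integrable_entry_of_exp_moment[OF P \<open>0 < s0\<close> that H[OF that] mom])
  obtain N :: "('i \<Rightarrow> real) set" where N: "finite N" "real (card N) \<le> (3 * 2 ^ 16) ^ card P"
    "\<And>z. z \<in> N \<Longrightarrow> (\<Sum>b\<in>P. (z b)\<^sup>2) \<le> 1"
    "\<And>x. (\<Sum>b\<in>P. (x b)\<^sup>2) \<le> 1 \<Longrightarrow> \<exists>z\<in>N. L2_set (\<lambda>b. x b - z b) P \<le> 1/4"
    using unit_ball_net[OF P] by blast
  define X where "X = (\<lambda>(x, y) \<omega>. \<Sum>a\<in>P. \<Sum>b\<in>P. x a * H \<omega> a b * y b)"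
  have X[measurable]: "X q \<in> borel_measurable M" for q
    unfolding X_def case_prod_beta using H by measurable
  define S where "S = (\<lambda>q. {\<omega> \<in> space ?P. t / 2 < (\<Sum>l<n. X q (\<omega> l)) / real n - expectation (X q)})"
  define c where "c = min (s0\<^sup>2 / (16 * B * exp B)) (s0 / 4)"
  have c: "0 < c" using assms by (simp add: c_def)
  have S: "S q \<in> sets ?P" for q unfolding S_def by measurable
  have ES: "emeasure ?P (S q) \<le> ennreal (exp (- (c / 4 * real n * min t (t\<^sup>2))))" if "q \<in> N \<times> N" for q
  proof -
    have "(\<integral>\<^sup>+\<omega>. ennreal (exp (s0 * \<bar>X q \<omega>\<bar>)) \<partial>M) \<le> ennreal B"
      using mom N(3) that by (auto simp: X_def)
    then have "emeasure ?P (S q) \<le> ennreal (exp (- (c * real n * min (t / 2) ((t / 2)\<^sup>2))))"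
      unfolding S_def c_def using assms by (intro iid_mean_tail X) auto
    also have "\<dots> \<le> ennreal (exp (- (c / 4 * real n * min t (t\<^sup>2))))"
    proof -
      \<comment> \<open>The net only sees the level t/2; in the worst case this divides the exponent
        by 4, whence \<open>c / 4\<close>.\<close>
      have "1 / 4 * min t (t\<^sup>2) \<le> min (t / 2) ((t / 2)\<^sup>2)"
        using \<open>0 < t\<close> by (auto simp: min_def field_simps power2_eq_square)
      then have "c * real n * (1 / 4 * min t (t\<^sup>2)) \<le> c * real n * min (t / 2) ((t / 2)\<^sup>2)"
        using c by (intro mult_left_mono) auto
      then show ?thesis by (intro ennreal_leI) simp
    qed
    finally show ?thesis .
  qed
  show ?thesis
  proof (intro bexI conjI)
    show "(\<Union>q\<in>N \<times> N. S q) \<in> sets ?P" using S N by (intro sets.finite_UN) auto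
    show "{\<omega> \<in> space ?P. t < op_norm P (\<lambda>a b. (\<Sum>l<n. H (\<omega> l) a b) / real n
        - expectation (\<lambda>\<omega>. H \<omega> a b))} \<subseteq> (\<Union>q\<in>N \<times> N. S q)"
    proof safe
      fix \<omega> assume \<omega>: "\<omega> \<in> space ?P"
        and gt: "t < op_norm P (\<lambda>a b. (\<Sum>l<n. H (\<omega> l) a b) / real n - expectation (\<lambda>\<omega>. H \<omega> a b))"
      obtain x y where xy: "x \<in> N" "y \<in> N" and
        big: "t / 2 < (\<Sum>a\<in>P. \<Sum>b\<in>P. x a * ((\<Sum>l<n. H (\<omega> l) a b) / real n
          - expectation (\<lambda>\<omega>. H \<omega> a b)) * y b)"
        using op_norm_gt_net[OF P \<open>0 < t\<close> gt N(4) N(3)] by blast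
      define T where "T = (\<lambda>a b. \<Sum>l<n. H (\<omega> l) a b)"
      have "(\<Sum>l<n. X (x, y) (\<omega> l)) = (\<Sum>a\<in>P. \<Sum>b\<in>P. x a * T a b * y b)"
        unfolding X_def T_def
        by (simp add: sum_distrib_left sum_distrib_right, subst sum.swap,
            intro sum.cong refl, subst sum.swap, simp)
      moreover have "expectation (X (x, y)) = (\<Sum>a\<in>P. \<Sum>b\<in>P. x a * expectation (\<lambda>\<omega>. H \<omega> a b) * y b)"
        unfolding X_def using intH by (simp add: Bochner_Integration.integral_sum)
      ultimately have "(\<Sum>l<n. X (x, y) (\<omega> l)) / real n - expectation (X (x, y)) =
        (\<Sum>a\<in>P. \<Sum>b\<in>P. x a * (T a b / real n - expectation (\<lambda>\<omega>. H \<omega> a b)) * y b)"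
        by (simp add: sum_divide_distrib sum_subtractf[symmetric] algebra_simps)
      with big have "t / 2 < (\<Sum>l<n. X (x, y) (\<omega> l)) / real n - expectation (X (x, y))"
        unfolding T_def by linarith
      with \<omega> have "\<omega> \<in> S (x, y)" by (simp add: S_def)
      with xy show "\<omega> \<in> (\<Union>q\<in>N \<times> N. S q)" by blast
    qed
    have "emeasure ?P (\<Union>q\<in>N \<times> N. S q) \<le> (\<Sum>q\<in>N \<times> N. emeasure ?P (S q))"
      using N S by (intro emeasure_subadditive_finite) auto
    also have "\<dots> \<le> (\<Sum>q\<in>N \<times> N. ennreal (exp (- (c / 4 * real n * min t (t\<^sup>2)))))"
      by (intro sum_mono ES)
    also have "\<dots> = ennreal (real (card N * card N) * exp (- (c / 4 * real n * min t (t\<^sup>2))))"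
      by (simp add: card_cartesian_product ennreal_of_nat_eq_real_of_nat ennreal_mult[symmetric])
    also have "\<dots> \<le> ennreal ((3 * 2 ^ 16) ^ (2 * card P) * exp (- (c / 4 * real n * min t (t\<^sup>2))))"
    proof (intro ennreal_leI mult_right_mono)
      have "real (card N * card N) \<le> (3 * 2 ^ 16) ^ card P * (3 * 2 ^ 16) ^ card P"
        unfolding of_nat_mult using N(2) by (intro mult_mono) auto
      then show "real (card N * card N) \<le> (3 * 2 ^ 16) ^ (2 * card P)"
        by (simp only: power_add[symmetric] mult_2)
    qed simp
    finally show "emeasure ?P (\<Union>q\<in>N \<times> N. S q) \<le> ennreal ((3 * 2 ^ 16) ^ (2 * card P) *
      exp (- (min (s0\<^sup>2 / (16 * B * exp B)) (s0 / 4) / 4 * real n * min t (t\<^sup>2))))"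
      unfolding c_def .
  qed
qed

end

lemma op_norm_cong:
  "(\<And>a b. a \<in> P \<Longrightarrow> b \<in> P \<Longrightarrow> A a b = A' a b) \<Longrightarrow> op_norm P A = op_norm P A'"
  unfolding op_norm_def by (intro SUP_cong refl arg_cong[where f = sqrt] sum.cong) auto

text \<open>Transfer to a matrix \<open>F\<close> that is the empirical mean only almost everywhere.
  The almost sure identity enters twice: it identifies the mean of \<open>F\<close> with the
  one-point expectation, where measurability of \<open>F\<close> is used, and its exceptional null
  set is added to the event \<open>S\<close>.\<close>

lemma (in prob_space) iid_matrix_mean_tail_AE:
  fixes H :: "'a \<Rightarrow> 'i \<Rightarrow> 'i \<Rightarrow> real" and F :: "(nat \<Rightarrow> 'a) \<Rightarrow> 'i \<Rightarrow> 'i \<Rightarrow> real"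
  defines "\<Omega> n \<equiv> Pi\<^sub>M {..<n} (\<lambda>_. M)"
  assumes P: "finite P" and pos: "0 < s0" "0 < B" "0 < t" "0 < n"
    and H: "\<And>a b. a \<in> P \<Longrightarrow> b \<in> P \<Longrightarrow> (\<lambda>\<omega>. H \<omega> a b) \<in> borel_measurable M"
    and mom: "\<And>x y. (\<Sum>b\<in>P. (x b)\<^sup>2) \<le> 1 \<Longrightarrow> (\<Sum>b\<in>P. (y b)\<^sup>2) \<le> 1 \<Longrightarrow>
      (\<integral>\<^sup>+\<omega>. ennreal (exp (s0 * \<bar>\<Sum>a\<in>P. \<Sum>b\<in>P. x a * H \<omega> a b * y b\<bar>)) \<partial>M) \<le> ennreal B"
    and F: "\<And>a b. a \<in> P \<Longrightarrow> b \<in> P \<Longrightarrow> (\<lambda>\<omega>. F \<omega> a b) \<in> borel_measurable (\<Omega> n)"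
    and eq: "AE \<omega> in \<Omega> n. \<forall>a\<in>P. \<forall>b\<in>P. F \<omega> a b = (\<Sum>l<n. H (\<omega> l) a b) / real n"
  shows "outer_measure_of (\<Omega> n)
      {\<omega> \<in> space (\<Omega> n). t < op_norm P (\<lambda>a b. F \<omega> a b - (\<integral>\<omega>'. F \<omega>' a b \<partial>\<Omega> n))}
    \<le> ennreal ((3 * 2 ^ 16) ^ (2 * card P) *
      exp (- (min (s0\<^sup>2 / (16 * B * exp B)) (s0 / 4) / 4 * real n * min t (t\<^sup>2))))"
proof -
  have mean: "(\<integral>\<omega>. F \<omega> a b \<partial>\<Omega> n) = expectation (\<lambda>\<omega>. H \<omega> a b)" if ab: "a \<in> P" "b \<in> P" for a b
  proof -
    note [measurable] = H[OF ab] F[OF ab, unfolded \<Omega>_def]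
    have intH: "integrable M (\<lambda>\<omega>. H \<omega> a b)"
      by (rule integrable_entry_of_exp_moment[OF P \<open>0 < s0\<close> ab H[OF ab] mom])
    have distr: "distr (\<Omega> n) M (\<lambda>\<omega>. \<omega> l) = M" if "l < n" for l
      unfolding \<Omega>_def by (rule distr_PiM_component) (use that prob_space_axioms in auto)
    have comp: "integrable (\<Omega> n) (\<lambda>\<omega>. H (\<omega> l) a b)"
      "(\<integral>\<omega>. H (\<omega> l) a b \<partial>\<Omega> n) = expectation (\<lambda>\<omega>. H \<omega> a b)" if l: "l < n" for l
    proof -
      have [measurable]: "(\<lambda>\<omega>. \<omega> l) \<in> measurable (\<Omega> n) M" using l by (simp add: \<Omega>_def)
      show "integrable (\<Omega> n) (\<lambda>\<omega>. H (\<omega> l) a b)"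
        using intH distr[OF l] integrable_distr[of "\<lambda>\<omega>. \<omega> l" "\<Omega> n" M "\<lambda>\<omega>. H \<omega> a b"] by simp
      show "(\<integral>\<omega>. H (\<omega> l) a b \<partial>\<Omega> n) = expectation (\<lambda>\<omega>. H \<omega> a b)"
        using distr[OF l] integral_distr[of "\<lambda>\<omega>. \<omega> l" "\<Omega> n" M "\<lambda>\<omega>. H \<omega> a b"] by simp
    qed
    have "(\<integral>\<omega>. F \<omega> a b \<partial>\<Omega> n) = (\<integral>\<omega>. (\<Sum>l<n. H (\<omega> l) a b) / real n \<partial>\<Omega> n)"
      unfolding \<Omega>_def
    proof (rule integral_cong_AE)
      show "AE \<omega> in Pi\<^sub>M {..<n} (\<lambda>_. M). F \<omega> a b = (\<Sum>l<n. H (\<omega> l) a b) / real n"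
        using eq ab unfolding \<Omega>_def by (auto elim: eventually_mono)
    qed measurable
    also have "\<dots> = expectation (\<lambda>\<omega>. H \<omega> a b)"
      using comp pos by (simp add: Bochner_Integration.integral_sum)
    finally show ?thesis .
  qed
  obtain S where S: "S \<in> sets (\<Omega> n)"
    "{\<omega> \<in> space (\<Omega> n). t < op_norm P (\<lambda>a b. (\<Sum>l<n. H (\<omega> l) a b) / real n
       - expectation (\<lambda>\<omega>. H \<omega> a b))} \<subseteq> S"
    "emeasure (\<Omega> n) S \<le> ennreal ((3 * 2 ^ 16) ^ (2 * card P) *
      exp (- (min (s0\<^sup>2 / (16 * B * exp B)) (s0 / 4) / 4 * real n * min t (t\<^sup>2))))"
    using iid_matrix_mean_tail[OF P pos H mom] unfolding \<Omega>_def by auto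
  obtain Z where Z: "Z \<in> null_sets (\<Omega> n)"
    "{\<omega> \<in> space (\<Omega> n). \<not> (\<forall>a\<in>P. \<forall>b\<in>P. F \<omega> a b = (\<Sum>l<n. H (\<omega> l) a b) / real n)} \<subseteq> Z"
    using eq by (auto elim!: AE_E simp: null_sets_def)
  have "{\<omega> \<in> space (\<Omega> n). t < op_norm P (\<lambda>a b. F \<omega> a b - (\<integral>\<omega>'. F \<omega>' a b \<partial>\<Omega> n))} \<subseteq> S \<union> Z"
  proof safe
    fix \<omega> assume \<omega>: "\<omega> \<in> space (\<Omega> n)" "\<omega> \<notin> Z"
      and gt: "t < op_norm P (\<lambda>a b. F \<omega> a b - (\<integral>\<omega>'. F \<omega>' a b \<partial>\<Omega> n))"
    have "op_norm P (\<lambda>a b. F \<omega> a b - (\<integral>\<omega>'. F \<omega>' a b \<partial>\<Omega> n)) =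
        op_norm P (\<lambda>a b. (\<Sum>l<n. H (\<omega> l) a b) / real n - expectation (\<lambda>\<omega>. H \<omega> a b))"
      using \<omega> Z(2) by (intro op_norm_cong) (auto simp: mean)
    with gt \<omega> S(2) show "\<omega> \<in> S" by auto
  qed
  then have "outer_measure_of (\<Omega> n)
      {\<omega> \<in> space (\<Omega> n). t < op_norm P (\<lambda>a b. F \<omega> a b - (\<integral>\<omega>'. F \<omega>' a b \<partial>\<Omega> n))}
    \<le> outer_measure_of (\<Omega> n) (S \<union> Z)" by (rule outer_measure_of_mono)
  also have "\<dots> = emeasure (\<Omega> n) (S \<union> Z)" using S(1) Z(1) by (intro outer_measure_of_eq) auto
  also have "\<dots> = emeasure (\<Omega> n) S" by (rule emeasure_Un_null_set[OF S(1) Z(1)])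
  finally show ?thesis using S(3) by (rule order_trans)
qed

section \<open>Gaussian mixtures\<close>

abbreviation gauss :: "nat \<Rightarrow> real \<Rightarrow> (nat \<Rightarrow> real) measure" where
  "gauss d lam \<equiv> PiM {..<d} (\<lambda>_. density lborel (normal_density 0 (1 / sqrt lam)))"

lemma prob_space_gauss: "0 < lam \<Longrightarrow> prob_space (gauss d lam)"
  by (intro prob_space_PiM prob_space_normal_density) simp

text \<open>\<open>sum_indep_normal\<close> asks for positive standard deviations and a nonempty
  index set. Coordinates with coefficient 0 are therefore dropped before the sum is formed and
  restored afterwards.\<close>

lemma distributed_gauss_linear:
  fixes u :: "nat \<Rightarrow> real"
  assumes lam: "0 < lam" and u: "\<exists>j<d. u j \<noteq> 0"
  shows "distributed (gauss d lam) lborel (\<lambda>Z. \<Sum>j<d. u j * Z j)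
    (normal_density 0 (sqrt (\<Sum>j<d. (u j)\<^sup>2) / sqrt lam))"
proof -
  let ?N = "density lborel (normal_density 0 (1 / sqrt lam))"
  let ?G = "gauss d lam"
  interpret N: prob_space ?N using lam by (intro prob_space_normal_density) simp
  interpret prob_space ?G using lam by (rule prob_space_gauss)
  have comp: "distr ?G ?N (\<lambda>Z. Z i) = ?N" if "i < d" for i
    by (rule distr_PiM_component) (use that N.prob_space_axioms in auto)
  have "indep_vars (\<lambda>_. ?N) (\<lambda>j Z. Z j) {..<d}"
  proof (subst indep_vars_iff_distr_eq_PiM')
    have "distr ?G (Pi\<^sub>M {..<d} (\<lambda>_. ?N)) (\<lambda>Z. \<lambda>i\<in>{..<d}. Z i) = distr ?G ?G (\<lambda>Z. Z)"
      by (intro distr_cong refl) (auto simp: space_PiM PiE_restrict)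
    also have "\<dots> = Pi\<^sub>M {..<d} (\<lambda>i. distr ?G ?N (\<lambda>Z. Z i))"
      using comp by (auto simp: distr_id intro!: PiM_cong)
    finally show "distr ?G (Pi\<^sub>M {..<d} (\<lambda>_. ?N)) (\<lambda>Z. \<lambda>i\<in>{..<d}. Z i) = \<dots>" .
  qed (use u in auto)
  then have "indep_vars (\<lambda>_. borel) (\<lambda>j Z. u j * Z j) {..<d}"
    by (rule indep_vars_compose2) auto
  then have indep: "indep_vars (\<lambda>_. borel) (\<lambda>j Z. u j * Z j) {j \<in> {..<d}. u j \<noteq> 0}"
    by (rule indep_vars_subset) auto
  have "distributed ?G lborel (\<lambda>Z. \<Sum>j\<in>{j \<in> {..<d}. u j \<noteq> 0}. u j * Z j)
    (normal_density (\<Sum>j\<in>{j \<in> {..<d}. u j \<noteq> 0}. 0)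
      (sqrt (\<Sum>j\<in>{j \<in> {..<d}. u j \<noteq> 0}. (\<bar>u j\<bar> * (1 / sqrt lam))\<^sup>2)))"
  proof (rule sum_indep_normal[OF _ _ indep])
    fix j assume j: "j \<in> {j \<in> {..<d}. u j \<noteq> 0}"
    have "distributed ?G lborel (\<lambda>Z. Z j) (normal_density 0 (1 / sqrt lam))"
    proof -
      have "distr ?G lborel (\<lambda>Z. Z j) = distr ?G ?N (\<lambda>Z. Z j)" by (intro distr_cong) auto
      then show ?thesis using comp[of j] j by (auto simp: distributed_def)
    qed
    from normal_density_affine[OF this, of "u j" 0] j lam
    show "distributed ?G lborel (\<lambda>Z. u j * Z j) (normal_density 0 (\<bar>u j\<bar> * (1 / sqrt lam)))"
      by simp
    show "0 < \<bar>u j\<bar> * (1 / sqrt lam)" using j lam by simp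
  qed (use u in auto)
  moreover have "(\<Sum>j\<in>{j \<in> {..<d}. u j \<noteq> 0}. u j * Z j) = (\<Sum>j<d. u j * Z j)" for Z
    by (intro sum.mono_neutral_left) auto
  moreover have "(\<Sum>j\<in>{j \<in> {..<d}. u j \<noteq> 0}. (\<bar>u j\<bar> * (1 / sqrt lam))\<^sup>2) = (\<Sum>j<d. (u j)\<^sup>2) / lam"
  proof -
    have "(\<Sum>j\<in>{j \<in> {..<d}. u j \<noteq> 0}. (\<bar>u j\<bar> * (1 / sqrt lam))\<^sup>2) = (\<Sum>j<d. (\<bar>u j\<bar> * (1 / sqrt lam))\<^sup>2)"
      by (intro sum.mono_neutral_left) auto
    then show ?thesis using lam by (simp add: power_mult_distrib power_divide sum_divide_distrib)
  qed
  ultimately show ?thesis using lam by (simp add: real_sqrt_divide)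
qed

text \<open>For standard deviation \<sigma> <= 1 the tilt exp (x^2 / 4) at most doubles the
  variance: the tilted density is bounded by \<open>sqrt 2\<close> times the normal density of
  standard deviation sqrt 2 \<sigma>. This is where \<open>1 \<le> lam\<close> enters, and it makes
  the bound free of both \<open>d\<close> and \<open>lam\<close>. A vanishing \<open>u\<close> has
  no density and is treated apart.\<close>

lemma gauss_exp_square_le:
  assumes lam: "1 \<le> lam" and u: "(\<Sum>j<d. (u j)\<^sup>2) \<le> 1"
  shows "(\<integral>\<^sup>+Z. ennreal (exp ((\<Sum>j<d. u j * Z j)\<^sup>2 / 4)) \<partial>gauss d lam) \<le> ennreal (sqrt 2)"
proof (cases "\<exists>j<d. u j \<noteq> 0")
  case False
  interpret prob_space "gauss d lam" using lam by (intro prob_space_gauss) simp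
  have "1 \<le> ennreal (sqrt 2)" by (simp flip: ennreal_1 add: ennreal_leI)
  with False show ?thesis by (simp add: emeasure_space_1)
next
  case True
  define \<sigma> where "\<sigma> = sqrt (\<Sum>j<d. (u j)\<^sup>2) / sqrt lam"
  have "0 < (\<Sum>j<d. (u j)\<^sup>2)" using True by (auto intro!: sum_pos2)
  moreover have "sqrt (\<Sum>j<d. (u j)\<^sup>2) \<le> 1 * sqrt lam"
    using lam u by (auto simp: intro!: order_trans[OF _ mult_left_mono[of 1 "sqrt lam" 1]])
  ultimately have \<sigma>: "0 < \<sigma>" "\<sigma> \<le> 1" using lam by (simp_all add: \<sigma>_def)
  have "distributed (gauss d lam) lborel (\<lambda>Z. \<Sum>j<d. u j * Z j) (normal_density 0 \<sigma>)"
    unfolding \<sigma>_def using lam True by (intro distributed_gauss_linear) auto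
  from distributed_nn_integral[OF this, of "\<lambda>x. ennreal (exp (x\<^sup>2 / 4))"]
  have "(\<integral>\<^sup>+Z. ennreal (exp ((\<Sum>j<d. u j * Z j)\<^sup>2 / 4)) \<partial>gauss d lam) =
    (\<integral>\<^sup>+x. ennreal (normal_density 0 \<sigma> x) * ennreal (exp (x\<^sup>2 / 4)) \<partial>lborel)" by simp
  also have "\<dots> \<le> (\<integral>\<^sup>+x. ennreal (sqrt 2) * ennreal (normal_density 0 (sqrt 2 * \<sigma>) x) \<partial>lborel)"
  proof (intro nn_integral_mono)
    fix x :: real
    have "x\<^sup>2 * \<sigma>\<^sup>2 \<le> x\<^sup>2 * 1" using \<sigma> by (intro mult_left_mono) (auto simp: power_le_one)
    then have "x\<^sup>2 \<le> x\<^sup>2 / \<sigma>\<^sup>2" using \<sigma> by (simp add: pos_le_divide_eq)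
    then have "- x\<^sup>2 / (2 * \<sigma>\<^sup>2) + x\<^sup>2 / 4 \<le> - x\<^sup>2 / (2 * (sqrt 2 * \<sigma>)\<^sup>2)"
      by (simp add: power_mult_distrib)
    then have "exp (- x\<^sup>2 / (2 * \<sigma>\<^sup>2)) * exp (x\<^sup>2 / 4) \<le> exp (- x\<^sup>2 / (2 * (sqrt 2 * \<sigma>)\<^sup>2))"
      unfolding exp_add[symmetric] by simp
    then have "normal_density 0 \<sigma> x * exp (x\<^sup>2 / 4) \<le> sqrt 2 * normal_density 0 (sqrt 2 * \<sigma>) x"
      using \<sigma> by (simp add: normal_density_def power_mult_distrib real_sqrt_mult field_simps
          flip: mult.assoc[of "sqrt 2" "sqrt 2"])
    then show "ennreal (normal_density 0 \<sigma> x) * ennreal (exp (x\<^sup>2 / 4)) \<le>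
        ennreal (sqrt 2) * ennreal (normal_density 0 (sqrt 2 * \<sigma>) x)"
      by (simp add: ennreal_mult[symmetric] ennreal_leI)
  qed
  also have "\<dots> = ennreal (sqrt 2)"
  proof -
    interpret prob_space "density lborel (normal_density 0 (sqrt 2 * \<sigma>))"
      using \<sigma> by (intro prob_space_normal_density) simp
    show ?thesis using emeasure_space_1 by (simp add: nn_integral_cmult emeasure_density)
  qed
  finally show ?thesis .
qed

text \<open>A nonzero linear form of the noise has a density, hence no atoms. The constant
  \<open>c\<close> is later minus the projection of the mixture center.\<close>

lemma AE_gauss_linear_neq:
  assumes lam: "0 < lam" and u: "\<exists>j<d. u j \<noteq> 0"
  shows "AE Z in gauss d lam. (\<Sum>j<d. u j * Z j) \<noteq> c"
proof -
  note D = distributed_gauss_linear[OF lam u]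
  have "AE x in density lborel (normal_density 0 (sqrt (\<Sum>j<d. (u j)\<^sup>2) / sqrt lam)). x \<noteq> c"
    by (subst AE_density) (auto intro: AE_mp[OF AE_lborel_singleton])
  then have "AE x in distr (gauss d lam) lborel (\<lambda>Z. \<Sum>j<d. u j * Z j). x \<noteq> c"
    by (subst distributed_distr_eq_density[OF D])
  then show ?thesis by (rule AE_distrD[rotated]) measurable
qed

lemma prob_space_point_law: "0 < lam \<Longrightarrow> prob_space (point_law d lam)"
  unfolding point_law_def
  by (intro prob_space_pair measure_pmf.prob_space_axioms prob_space_gauss)

lemma measurable_data_point [measurable]:
  "j < d \<Longrightarrow> (\<lambda>\<omega>. snd (data_point d \<mu> \<nu> \<omega>) j) \<in> borel_measurable (point_law d lam)"
  "(\<lambda>\<omega>. fst (data_point d \<mu> \<nu> \<omega>)) \<in> borel_measurable (point_law d lam)"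
  unfolding data_point_def point_law_def case_prod_beta by simp_all measurable

text \<open>Conditioning on label and sign by Tonelli: a bound for each of the four Gaussian
  components passes to the mixture.\<close>

lemma nn_integral_point_law_le:
  assumes lam: "0 < lam" and f: "f \<in> borel_measurable (point_law d lam)"
    and C: "\<And>b s. (\<integral>\<^sup>+Z. f (b, s, Z) \<partial>gauss d lam) \<le> C"
  shows "(\<integral>\<^sup>+\<omega>. f \<omega> \<partial>point_law d lam) \<le> C"
proof -
  let ?B = "measure_pmf (pmf_of_set (UNIV :: bool set))"
  interpret G: prob_space "gauss d lam" using lam by (rule prob_space_gauss)
  interpret BG: prob_space "?B \<Otimes>\<^sub>M gauss d lam"
    by (intro prob_space_pair measure_pmf.prob_space_axioms G.prob_space_axioms)
  have f[measurable]: "f \<in> borel_measurable (?B \<Otimes>\<^sub>M (?B \<Otimes>\<^sub>M gauss d lam))"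
    using f unfolding point_law_def .
  have "(\<integral>\<^sup>+\<omega>. f \<omega> \<partial>point_law d lam) = (\<integral>\<^sup>+b. \<integral>\<^sup>+q. f (b, q) \<partial>(?B \<Otimes>\<^sub>M gauss d lam) \<partial>?B)"
    unfolding point_law_def by (rule BG.nn_integral_fst[symmetric]) (rule f)
  also have "\<dots> = (\<integral>\<^sup>+b. \<integral>\<^sup>+s. \<integral>\<^sup>+Z. f (b, s, Z) \<partial>gauss d lam \<partial>?B \<partial>?B)"
    by (intro nn_integral_cong G.nn_integral_fst[symmetric]) measurable
  also have "\<dots> \<le> (\<integral>\<^sup>+b. \<integral>\<^sup>+s. C \<partial>?B \<partial>?B)" by (intro nn_integral_mono C)
  also have "\<dots> = C" by (simp add: measure_pmf.emeasure_space_1)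
  finally show ?thesis .
qed

text \<open>With the projected center c and the projected noise g, (c + g)^2 <= 2 c^2 + 2 g^2 and
  |c| <= 1 by Cauchy-Schwarz. For a <= 1/8 the center contributes at most \<open>exp (1/4)\<close>
  and the noise at most the tilt \<open>g\<^sup>2 / 4\<close> of the Gaussian lemma, hence
  \<open>sqrt 2\<close>.\<close>

lemma point_law_exp_square_le:
  assumes lam: "1 \<le> lam" and u: "(\<Sum>j<d. (u j)\<^sup>2) \<le> 1" and o: "orthonormal2 d \<mu> \<nu>"
    and a: "0 \<le> a" "a \<le> 1/8"
  shows "(\<integral>\<^sup>+\<omega>. ennreal (exp (a * (\<Sum>j<d. u j * snd (data_point d \<mu> \<nu> \<omega>) j)\<^sup>2)) \<partial>point_law d lam)
    \<le> ennreal (exp (1/4) * sqrt 2)"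
proof (rule nn_integral_point_law_le)
  fix b s :: bool
  define m where "m = (\<lambda>j. (if s then 1 else -1) * (if b then \<mu> j else \<nu> j))"
  have m: "(\<Sum>j<d. (m j)\<^sup>2) = 1" using o by (cases b; cases s) (auto simp: m_def orthonormal2_def)
  have "(\<Sum>j<d. u j * m j)\<^sup>2 \<le> (\<Sum>j<d. (u j)\<^sup>2) * (\<Sum>j<d. (m j)\<^sup>2)"
    by (rule Cauchy_Schwarz_ineq_sum)
  then have um: "(\<Sum>j<d. u j * m j)\<^sup>2 \<le> 1" using m u by simp
  have "(\<integral>\<^sup>+Z. ennreal (exp (a * (\<Sum>j<d. u j * snd (data_point d \<mu> \<nu> (b, s, Z)) j)\<^sup>2)) \<partial>gauss d lam)
    \<le> (\<integral>\<^sup>+Z. ennreal (exp (1/4)) * ennreal (exp ((\<Sum>j<d. u j * Z j)\<^sup>2 / 4)) \<partial>gauss d lam)"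
  proof (intro nn_integral_mono)
    fix Z
    define g where "g = (\<Sum>j<d. u j * Z j)"
    define c where "c = (\<Sum>j<d. u j * m j)"
    have e: "(\<Sum>j<d. u j * snd (data_point d \<mu> \<nu> (b, s, Z)) j) = c + g"
      by (simp add: data_point_def m_def c_def g_def sum.distrib[symmetric] distrib_left)
    have "(c + g)\<^sup>2 \<le> 2 * c\<^sup>2 + 2 * g\<^sup>2"
      using sum_squares_bound[of c g] by (simp add: power2_sum)
    also have "\<dots> \<le> 2 + 2 * g\<^sup>2" using um by (simp add: c_def)
    finally have "a * (c + g)\<^sup>2 \<le> 1/8 * (2 + 2 * g\<^sup>2)" using a by (intro mult_mono) auto
    then have "exp (a * (c + g)\<^sup>2) \<le> exp (1/4) * exp (g\<^sup>2 / 4)"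
      by (simp add: exp_add[symmetric])
    then show "ennreal (exp (a * (\<Sum>j<d. u j * snd (data_point d \<mu> \<nu> (b, s, Z)) j)\<^sup>2))
        \<le> ennreal (exp (1/4)) * ennreal (exp ((\<Sum>j<d. u j * Z j)\<^sup>2 / 4))"
      unfolding e g_def[symmetric] by (simp add: ennreal_mult[symmetric] ennreal_leI)
  qed
  also have "\<dots> = ennreal (exp (1/4)) * (\<integral>\<^sup>+Z. ennreal (exp ((\<Sum>j<d. u j * Z j)\<^sup>2 / 4)) \<partial>gauss d lam)"
    by (intro nn_integral_cmult) measurable
  also have "\<dots> \<le> ennreal (exp (1/4)) * ennreal (sqrt 2)"
    by (intro mult_left_mono gauss_exp_square_le lam u) simp
  finally show "(\<integral>\<^sup>+Z. ennreal (exp (a * (\<Sum>j<d. u j * snd (data_point d \<mu> \<nu> (b, s, Z)) j)\<^sup>2)) \<partial>gauss d lam)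
    \<le> ennreal (exp (1/4) * sqrt 2)" by (simp add: ennreal_mult)
qed (use lam in \<open>simp, measurable\<close>)

text \<open>The moment reduction to fixed label and sign is applied to the indicator of the bad
  event with bound 0.\<close>

lemma AE_point_law_linear_neq:
  assumes lam: "0 < lam" and u: "\<exists>j<d. u j \<noteq> 0"
  shows "AE \<omega> in point_law d lam. (\<Sum>j<d. u j * snd (data_point d \<mu> \<nu> \<omega>) j) \<noteq> 0"
proof -
  let ?B = "measure_pmf (pmf_of_set (UNIV :: bool set))"
  let ?A = "{\<omega> \<in> space (point_law d lam). (\<Sum>j<d. u j * snd (data_point d \<mu> \<nu> \<omega>) j) = 0}"
  have A[measurable]: "?A \<in> sets (point_law d lam)" by measurable
  have "emeasure (point_law d lam) ?A = (\<integral>\<^sup>+\<omega>. indicator ?A \<omega> \<partial>point_law d lam)"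
    using A by simp
  also have "\<dots> \<le> 0"
  proof (rule nn_integral_point_law_le[OF lam])
    fix b s :: bool
    define c where "c = (\<Sum>j<d. u j * ((if s then 1 else -1) * (if b then \<mu> j else \<nu> j)))"
    have e: "(\<Sum>j<d. u j * snd (data_point d \<mu> \<nu> (b, s, Z)) j) = c + (\<Sum>j<d. u j * Z j)" for Z
      by (simp add: data_point_def c_def sum.distrib[symmetric] distrib_left)
    have "(\<integral>\<^sup>+Z. indicator ?A (b, s, Z) \<partial>gauss d lam) \<le> (\<integral>\<^sup>+Z. 0 \<partial>gauss d lam)"
      using AE_gauss_linear_neq[OF lam u, of "-c"]
      by (intro nn_integral_mono_AE) (auto simp: indicator_def e)
    then show "(\<integral>\<^sup>+Z. indicator ?A (b, s, Z) \<partial>gauss d lam) \<le> 0" by simp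
  qed (use A in measurable)
  finally have "?A \<in> null_sets (point_law d lam)" using A by (auto simp: null_sets_def)
  then show ?thesis by (rule AE_I') auto
qed

section \<open>Derivatives of the empirical risk\<close>

text \<open>The preactivation of unit \<open>i\<close>. It is applied to test vectors as well as to
  parameters, and then gives the projection of the data point onto the \<open>i\<close>-th row of
  the test vector.\<close>

definition pre :: "nat \<Rightarrow> (nat + nat \<times> nat \<Rightarrow> real) \<Rightarrow> nat \<Rightarrow> (nat \<Rightarrow> real) \<Rightarrow> real" where
  "pre d \<theta> i Y = (\<Sum>j<d. \<theta> (Inr (i, j)) * Y j)"

text \<open>The derivative of relu (u + s * x) in s at 0, with the kink value m x when u = 0: m = 0 is the
  convention of pd for a single data point, m x = max x 0 and m x = min x 0 give the right and the left
  derivative.\<close>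
definition relu_slope :: "(real \<Rightarrow> real) \<Rightarrow> real \<Rightarrow> real \<Rightarrow> real" where
  "relu_slope m u x = (if 0 < u then x else if u < 0 then 0 else m x)"

definition net_grad :: "(real \<Rightarrow> real) \<Rightarrow> nat \<Rightarrow> (nat + nat \<times> nat \<Rightarrow> real) \<Rightarrow> (nat \<Rightarrow> real)
    \<Rightarrow> nat + nat \<times> nat \<Rightarrow> real" where
  "net_grad m d \<theta> Y a = (case a of Inl i \<Rightarrow> relu (pre d \<theta> i Y)
     | Inr (i, j) \<Rightarrow> \<theta> (Inl i) * relu_slope m (pre d \<theta> i Y) (Y j))"

text \<open>Second derivatives of the network away from the kinks: it is linear in the outer weights
  and locally linear in the inner ones, so only an outer weight and the row of the same unit
  interact.\<close>

definition net_hess :: "nat \<Rightarrow> (nat + nat \<times> nat \<Rightarrow> real) \<Rightarrow> (nat \<Rightarrow> real)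
    \<Rightarrow> nat + nat \<times> nat \<Rightarrow> nat + nat \<times> nat \<Rightarrow> real" where
  "net_hess d \<theta> Y a b = (case (a, b) of
     (Inl i, Inr (k, j)) \<Rightarrow> if i = k then relu_slope (\<lambda>_. 0) (pre d \<theta> k Y) (Y j) else 0
   | (Inr (k, j), Inl i) \<Rightarrow> if i = k then relu_slope (\<lambda>_. 0) (pre d \<theta> k Y) (Y j) else 0
   | _ \<Rightarrow> 0)"

definition sigmoid :: "real \<Rightarrow> real" where
  "sigmoid z = exp z / (1 + exp z)"

text \<open>The derivative of the loss with respect to the network output.\<close>

definition resid :: "nat \<Rightarrow> nat \<Rightarrow> (nat + nat \<times> nat \<Rightarrow> real) \<Rightarrow> real \<times> (nat \<Rightarrow> real) \<Rightarrow> real" where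
  "resid K d \<theta> p = sigmoid (net K d \<theta> (snd p)) - fst p"

text \<open>The second-order chain rule away from the kinks; the quotient in front is the derivative
  of \<open>sigmoid\<close>.\<close>

definition loss_hess :: "nat \<Rightarrow> nat \<Rightarrow> (nat + nat \<times> nat \<Rightarrow> real) \<Rightarrow> real \<times> (nat \<Rightarrow> real)
    \<Rightarrow> nat + nat \<times> nat \<Rightarrow> nat + nat \<times> nat \<Rightarrow> real" where
  "loss_hess K d \<theta> p a b =
     exp (net K d \<theta> (snd p)) / (1 + exp (net K d \<theta> (snd p)))\<^sup>2
       * net_grad (\<lambda>_. 0) d \<theta> (snd p) a * net_grad (\<lambda>_. 0) d \<theta> (snd p) b
     + resid K d \<theta> p * net_hess d \<theta> (snd p) a b"

definition risk :: "nat \<Rightarrow> nat \<Rightarrow> nat \<Rightarrow> (nat \<Rightarrow> real \<times> (nat \<Rightarrow> real))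
    \<Rightarrow> (nat + nat \<times> nat \<Rightarrow> real) \<Rightarrow> real" where
  "risk K d M p \<theta> = (\<Sum>l<M. loss K d \<theta> (p l)) / real M"

definition risk_grad :: "(real \<Rightarrow> real) \<Rightarrow> nat \<Rightarrow> nat \<Rightarrow> nat \<Rightarrow> (nat \<Rightarrow> real \<times> (nat \<Rightarrow> real))
    \<Rightarrow> (nat + nat \<times> nat \<Rightarrow> real) \<Rightarrow> nat + nat \<times> nat \<Rightarrow> real" where
  "risk_grad m K d M p \<theta> a =
     (\<Sum>l<M. resid K d \<theta> (p l) * net_grad m d \<theta> (snd (p l)) a) / real M"

lemma net_pre: "net K d \<theta> Y = (\<Sum>i<K. \<theta> (Inl i) * relu (pre d \<theta> i Y))"
  by (simp add: net_def pre_def)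

abbreviation pre_dir :: "nat \<Rightarrow> nat + nat \<times> nat \<Rightarrow> nat \<Rightarrow> (nat \<Rightarrow> real) \<Rightarrow> real" where
  "pre_dir d a i Y \<equiv> (case a of Inl _ \<Rightarrow> 0 | Inr (k, j) \<Rightarrow> if k = i \<and> j < d then Y j else 0)"

lemma pre_upd:
  "pre d (\<theta>(a := s)) i Y = pre d \<theta> i Y
     + (s - \<theta> a) * pre_dir d a i Y"
proof (cases a)
  case (Inl k)
  then show ?thesis by (simp add: pre_def)
next
  case (Inr q)
  obtain k j where a: "a = Inr (k, j)" using Inr by (cases q) auto
  have "pre d (\<theta>(a := s)) i Y = (\<Sum>j'<d. \<theta> (Inr (i, j')) * Y j'
      + (if j' = j then if k = i then (s - \<theta> a) * Y j else 0 else 0))"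
    unfolding pre_def by (intro sum.cong) (auto simp: a algebra_simps)
  also have "\<dots> = pre d \<theta> i Y + (if j < d then if k = i then (s - \<theta> a) * Y j else 0 else 0)"
    by (simp add: sum.distrib pre_def)
  finally show ?thesis by (simp add: a)
qed

text \<open>For \<open>u \<noteq> 0\<close> the sign is locally constant and the function is
  eventually affine, so the premise only concerns the kink. Taking \<open>S\<close> to be a half
  line yields one-sided derivatives there; with \<open>S\<close> the whole line the lemma covers
  two-sided derivatives off the kink.\<close>

lemma relu_has_derivative:
  assumes "u = 0 \<Longrightarrow> \<forall>s\<in>S. relu ((s - w) * x) = (s - w) * m x"
  shows "((\<lambda>s. relu (u + (s - w) * x)) has_field_derivative relu_slope m u x) (at w within S)"
proof -
  have lim: "((\<lambda>s. u + (s - w) * x) \<longlongrightarrow> u + (w - w) * x) (at w within S)"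
    by (intro tendsto_intros)
  have "\<forall>\<^sub>F s in at w within S. relu (u + (s - w) * x) = relu u + (s - w) * relu_slope m u x"
  proof (cases u "0::real" rule: linorder_cases)
    case less
    have "\<forall>\<^sub>F s in at w within S. u + (s - w) * x < 0" using order_tendstoD(2)[OF lim] less by simp
    then show ?thesis by eventually_elim (use less in \<open>auto simp: relu_def relu_slope_def\<close>)
  next
    case equal
    have "\<forall>\<^sub>F s in at w within S. s \<in> S" by (simp add: eventually_at_filter)
    then show ?thesis
      by eventually_elim (use assms equal in \<open>auto simp: relu_slope_def relu_def\<close>)
  next
    case greater
    have "\<forall>\<^sub>F s in at w within S. 0 < u + (s - w) * x" using order_tendstoD(1)[OF lim] greater by simp
    then show ?thesis by eventually_elim (use greater in \<open>auto simp: relu_def relu_slope_def\<close>)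
  qed
  moreover have "((\<lambda>s. relu u + (s - w) * relu_slope m u x) has_field_derivative relu_slope m u x)
      (at w within S)"
    by (auto intro!: derivative_eq_intros)
  ultimately show ?thesis
    by (subst has_field_derivative_cong_eventually) auto
qed

lemma net_has_derivative:
  assumes a: "a \<in> par_idx K d"
    and S: "\<And>i j. a = Inr (i, j) \<Longrightarrow> pre d \<theta> i Y = 0 \<Longrightarrow>
      \<forall>s\<in>S. relu ((s - \<theta> a) * Y j) = (s - \<theta> a) * m (Y j)"
  shows "((\<lambda>s. net K d (\<theta>(a := s)) Y) has_field_derivative net_grad m d \<theta> Y a) (at (\<theta> a) within S)"
proof (cases a)
  case (Inl i)
  then have i: "i < K" using a by (auto simp: par_idx_def)
  have "net K d (\<theta>(a := s)) Y = (\<Sum>k<K. \<theta> (Inl k) * relu (pre d \<theta> k Y)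
      + (if k = i then (s - \<theta> a) * relu (pre d \<theta> i Y) else 0))" for s
    unfolding net_pre by (intro sum.cong) (auto simp: Inl pre_upd algebra_simps)
  then have "net K d (\<theta>(a := s)) Y = net K d \<theta> Y + (s - \<theta> a) * relu (pre d \<theta> i Y)" for s
    using i by (simp add: sum.distrib net_pre)
  then show ?thesis by (auto simp: Inl net_grad_def intro!: derivative_eq_intros)
next
  case (Inr q)
  then obtain i j where q: "a = Inr (i, j)" "i < K" "j < d" using a by (auto simp: par_idx_def)
  define r where "r = (\<Sum>k\<in>{..<K} - {i}. \<theta> (Inl k) * relu (pre d \<theta> k Y))"
  have "net K d (\<theta>(a := s)) Y = \<theta> (Inl i) * relu (pre d \<theta> i Y + (s - \<theta> a) * Y j) + r" for s
    unfolding net_pre r_def using q by (subst sum.remove[of _ i]) (auto simp: pre_upd intro!: sum.cong)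
  moreover have "((\<lambda>s. \<theta> (Inl i) * relu (pre d \<theta> i Y + (s - \<theta> a) * Y j) + r) has_field_derivative
      \<theta> (Inl i) * relu_slope m (pre d \<theta> i Y) (Y j)) (at (\<theta> a) within S)"
    using S[OF q(1)] by (auto intro!: derivative_eq_intros relu_has_derivative)
  ultimately show ?thesis by (simp add: q(1) net_grad_def)
qed

lemma loss_has_derivative:
  assumes a: "a \<in> par_idx K d"
    and S: "\<And>i j. a = Inr (i, j) \<Longrightarrow> pre d \<theta> i (snd p) = 0 \<Longrightarrow>
      \<forall>s\<in>S. relu ((s - \<theta> a) * snd p j) = (s - \<theta> a) * m (snd p j)"
  shows "((\<lambda>s. loss K d (\<theta>(a := s)) p) has_field_derivative
    resid K d \<theta> p * net_grad m d \<theta> (snd p) a) (at (\<theta> a) within S)"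
proof -
  have pos: "0 < 1 + exp z" for z :: real by (simp add: add_pos_pos)
  have "((\<lambda>z. - fst p * z + ln (1 + exp z)) has_field_derivative sigmoid z - fst p) (at z)" for z
    using pos[of z] by (auto simp: sigmoid_def divide_inverse intro!: derivative_eq_intros)
  moreover have "((\<lambda>s. net K d (\<theta>(a := s)) (snd p)) has_field_derivative
      net_grad m d \<theta> (snd p) a) (at (\<theta> a) within S)"
    using a S by (rule net_has_derivative)
  ultimately have "((\<lambda>s. - fst p * net K d (\<theta>(a := s)) (snd p) + ln (1 + exp (net K d (\<theta>(a := s)) (snd p))))
    has_field_derivative (sigmoid (net K d (\<theta>(a := \<theta> a)) (snd p)) - fst p) * net_grad m d \<theta> (snd p) a)
      (at (\<theta> a) within S)"
    by (intro DERIV_chain'[where f = "\<lambda>s. net K d (\<theta>(a := s)) (snd p)"])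
  then show ?thesis unfolding loss_def resid_def by simp
qed

lemma risk_has_derivative:
  assumes a: "a \<in> par_idx K d"
    and S: "\<And>l i j. l < M \<Longrightarrow> a = Inr (i, j) \<Longrightarrow> pre d \<theta> i (snd (p l)) = 0 \<Longrightarrow>
      \<forall>s\<in>S. relu ((s - \<theta> a) * snd (p l) j) = (s - \<theta> a) * m (snd (p l) j)"
  shows "((\<lambda>s. risk K d M p (\<theta>(a := s))) has_field_derivative risk_grad m K d M p \<theta> a) (at (\<theta> a) within S)"
  unfolding risk_def risk_grad_def
  by (intro DERIV_cdivide DERIV_sum loss_has_derivative a S) auto

section \<open>Partial derivatives at kinks and their default value\<close>

lemma pd_eqI: "((\<lambda>s. f (\<theta>(a := s))) has_field_derivative D) (at (\<theta> a)) \<Longrightarrow> pd f a \<theta> = D"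
  unfolding pd_def using DERIV_imp_deriv real_differentiable_def by auto

text \<open>Makes the default value of \<open>pd\<close> computable: two one-sided derivatives
  always exist for the functions at hand, and differentiability is their equality.\<close>

lemma pd_one_sided:
  assumes A: "((\<lambda>s. f (\<theta>(a := s))) has_field_derivative A) (at_right (\<theta> a))"
    and B: "((\<lambda>s. f (\<theta>(a := s))) has_field_derivative B) (at_left (\<theta> a))"
  shows "pd f a \<theta> = (if A = B then A else 0)"
proof (cases "A = B")
  case True
  have "((\<lambda>s. f (\<theta>(a := s))) has_field_derivative A) (at (\<theta> a))"
    using A B True unfolding has_field_derivative_iff by (simp add: filterlim_split_at)
  then show ?thesis using True by (simp add: pd_eqI)
next
  case False
  have "\<not> (\<lambda>s. f (\<theta>(a := s))) differentiable (at (\<theta> a))"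
  proof
    assume "(\<lambda>s. f (\<theta>(a := s))) differentiable (at (\<theta> a))"
    then obtain D where D: "((\<lambda>s. f (\<theta>(a := s))) has_field_derivative D) (at (\<theta> a))"
      by (meson real_differentiableE)
    have "((\<lambda>s. f (\<theta>(a := s))) has_field_derivative D) (at_right (\<theta> a))"
      "((\<lambda>s. f (\<theta>(a := s))) has_field_derivative D) (at_left (\<theta> a))"
      using D by (auto intro: has_field_derivative_at_within)
    with A B have "A = D" "B = D"
      unfolding has_field_derivative_iff by (auto intro: tendsto_unique[rotated])
    with False show False by simp
  qed
  then show ?thesis using False by (simp add: pd_def)
qed

lemma relu_right: "\<forall>s\<in>{w<..}. relu ((s - w) * x) = (s - w) * max x 0"
  by (auto simp: relu_def max_def zero_less_mult_iff mult_le_0_iff not_le less_le)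

lemma relu_left: "\<forall>s\<in>{..<w}. relu ((s - w) * x) = (s - w) * min x 0"
  by (auto simp: relu_def max_def min_def zero_less_mult_iff mult_le_0_iff not_le less_le)

text \<open>At a kink one of the two one-sided derivatives is 0, since \<open>max x 0\<close> or
  \<open>min x 0\<close> vanishes. If they agree, both are 0; if not, \<open>pd\<close> returns its
  default 0. Either way the slope at the kink is 0.\<close>

lemma pd_loss:
  assumes "a \<in> par_idx K d"
  shows "pd (\<lambda>\<theta>'. loss K d \<theta>' p) a \<theta> = resid K d \<theta> p * net_grad (\<lambda>_. 0) d \<theta> (snd p) a"
proof -
  have "pd (\<lambda>\<theta>'. loss K d \<theta>' p) a \<theta> =
    (let A = resid K d \<theta> p * net_grad (\<lambda>x. max x 0) d \<theta> (snd p) a;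
         B = resid K d \<theta> p * net_grad (\<lambda>x. min x 0) d \<theta> (snd p) a in if A = B then A else 0)"
    unfolding Let_def
    by (intro pd_one_sided loss_has_derivative assms relu_right relu_left)
  then show ?thesis
    by (auto simp: net_grad_def relu_slope_def Let_def max_def min_def split: sum.splits if_splits)
qed

text \<open>The equality test cannot be resolved as for a single point: jumps contributed by
  different samples may cancel, and the common one-sided derivative can then differ from the average
  of the single partial derivatives.\<close>

lemma pd_risk:
  assumes "a \<in> par_idx K d"
  shows "pd (risk K d M p) a \<theta> =
    (if risk_grad (\<lambda>x. max x 0) K d M p \<theta> a = risk_grad (\<lambda>x. min x 0) K d M p \<theta> a
     then risk_grad (\<lambda>x. max x 0) K d M p \<theta> a else 0)"
  by (intro pd_one_sided risk_has_derivative assms relu_right relu_left)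

lemma pd_risk_smooth:
  assumes "a \<in> par_idx K d" "\<And>l i. l < M \<Longrightarrow> i < K \<Longrightarrow> pre d \<theta> i (snd (p l)) \<noteq> 0"
  shows "pd (risk K d M p) a \<theta> = risk_grad (\<lambda>_. 0) K d M p \<theta> a"
  using assms by (intro pd_eqI risk_has_derivative) (auto simp: par_idx_def)

section \<open>The Hessian away from the kinks\<close>

lemma eventually_pre_upd:
  assumes "pre d \<theta> i Y \<noteq> 0"
  shows "\<forall>\<^sub>F s in nhds (\<theta> a). sgn (pre d (\<theta>(a := s)) i Y) = sgn (pre d \<theta> i Y)"
proof -
  define c where "c = pre_dir d a i Y"
  have lim: "((\<lambda>s. pre d \<theta> i Y + (s - \<theta> a) * c) \<longlongrightarrow> pre d \<theta> i Y + (\<theta> a - \<theta> a) * c) (nhds (\<theta> a))"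
    by (intro tendsto_intros filterlim_ident)
  show ?thesis
  proof (cases "0 < pre d \<theta> i Y")
    case True
    then have "\<forall>\<^sub>F s in nhds (\<theta> a). 0 < pre d \<theta> i Y + (s - \<theta> a) * c"
      using order_tendstoD(1)[OF lim] by simp
    then show ?thesis by eventually_elim (use True in \<open>simp add: pre_upd c_def\<close>)
  next
    case False
    then have "\<forall>\<^sub>F s in nhds (\<theta> a). pre d \<theta> i Y + (s - \<theta> a) * c < 0"
      using order_tendstoD(2)[OF lim] assms by simp
    then show ?thesis by eventually_elim (use False assms in \<open>simp add: pre_upd c_def\<close>)
  qed
qed

lemma relu_slope_sgn: "sgn u = sgn u' \<Longrightarrow> relu_slope m u x = relu_slope m u' x"
  by (auto simp: relu_slope_def sgn_if split: if_splits)

lemma net_grad_has_derivative: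
  assumes b: "b \<in> par_idx K d" and a: "a \<in> par_idx K d"
    and nz: "\<And>i. i < K \<Longrightarrow> pre d \<theta> i Y \<noteq> 0"
  shows "((\<lambda>s. net_grad (\<lambda>_. 0) d (\<theta>(a := s)) Y b) has_field_derivative net_hess d \<theta> Y a b) (at (\<theta> a))"
proof (cases b)
  case (Inl i)
  then have i: "i < K" using b by (auto simp: par_idx_def)
  define c where "c = pre_dir d a i Y"
  have "((\<lambda>s. relu (pre d \<theta> i Y + (s - \<theta> a) * c)) has_field_derivative
      relu_slope (\<lambda>_. 0) (pre d \<theta> i Y) c) (at (\<theta> a))"
    using nz[OF i] by (intro relu_has_derivative) auto
  moreover have "net_hess d \<theta> Y a b = relu_slope (\<lambda>_. 0) (pre d \<theta> i Y) c"
    using a by (auto simp: net_hess_def Inl c_def par_idx_def relu_slope_def split: sum.splits)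
  ultimately show ?thesis by (simp add: Inl net_grad_def pre_upd c_def)
next
  case (Inr q)
  then obtain i j where q: "b = Inr (i, j)" "i < K" "j < d" using b by (auto simp: par_idx_def)
  define r where "r = relu_slope (\<lambda>_. 0) (pre d \<theta> i Y) (Y j)"
  have "\<forall>\<^sub>F s in nhds (\<theta> a). net_grad (\<lambda>_. 0) d (\<theta>(a := s)) Y b = (\<theta>(a := s)) (Inl i) * r"
    using eventually_pre_upd[OF nz[OF q(2)], of a]
    by eventually_elim (auto simp: q(1) net_grad_def r_def intro: relu_slope_sgn)
  moreover have "((\<lambda>s. (\<theta>(a := s)) (Inl i) * r) has_field_derivative net_hess d \<theta> Y a b) (at (\<theta> a))"
  proof (cases "a = Inl i")
    case True
    then show ?thesis by (auto simp: net_hess_def q(1) r_def intro!: derivative_eq_intros)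
  next
    case False
    then have "net_hess d \<theta> Y a b = 0" by (auto simp: net_hess_def q(1) split: sum.splits)
    then show ?thesis using False by simp
  qed
  ultimately show ?thesis by (subst DERIV_cong_ev[OF refl _ refl])
qed

text \<open>The inner partial derivative has to be known on a neighbourhood of the parameter. The
  finitely many nonzero preactivations keep their signs on a common one, where the explicit gradient
  is valid and can be differentiated.\<close>

lemma hess_risk_smooth:
  assumes b: "b \<in> par_idx K d" and a: "a \<in> par_idx K d"
    and nz: "\<And>l i. l < M \<Longrightarrow> i < K \<Longrightarrow> pre d \<theta> i (snd (p l)) \<noteq> 0"
  shows "hess (risk K d M p) \<theta> a b = (\<Sum>l<M. loss_hess K d \<theta> (p l) a b) / real M"
proof -
  have "\<forall>\<^sub>F s in nhds (\<theta> a). \<forall>l\<in>{..<M}. \<forall>i\<in>{..<K}.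
      sgn (pre d (\<theta>(a := s)) i (snd (p l))) = sgn (pre d \<theta> i (snd (p l)))"
    using nz by (intro eventually_ball_finite ballI eventually_pre_upd) auto
  then have ev: "\<forall>\<^sub>F s in nhds (\<theta> a). pd (risk K d M p) b (\<theta>(a := s)) =
      risk_grad (\<lambda>_. 0) K d M p (\<theta>(a := s)) b"
  proof eventually_elim
    case (elim s)
    show ?case
      by (rule pd_risk_smooth[OF b]) (metis elim nz lessThan_iff sgn_0_0)
  qed
  have sig: "(sigmoid has_field_derivative exp z / (1 + exp z)\<^sup>2) (at z)" for z
  proof -
    have "1 + exp z \<noteq> 0" by (metis add_pos_pos exp_gt_zero less_irrefl zero_less_one)
    then show ?thesis unfolding sigmoid_def
      by (auto simp: power2_eq_square field_simps intro!: derivative_eq_intros)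
  qed
  have res: "((\<lambda>s. resid K d (\<theta>(a := s)) (p l)) has_field_derivative
      exp (net K d \<theta> (snd (p l))) / (1 + exp (net K d \<theta> (snd (p l))))\<^sup>2
        * net_grad (\<lambda>_. 0) d \<theta> (snd (p l)) a) (at (\<theta> a))" if "l < M" for l
  proof -
    have "((\<lambda>s. net K d (\<theta>(a := s)) (snd (p l))) has_field_derivative
        net_grad (\<lambda>_. 0) d \<theta> (snd (p l)) a) (at (\<theta> a))"
      using nz that a by (intro net_has_derivative) (auto simp: par_idx_def)
    from DERIV_chain'[OF this sig] show ?thesis
      unfolding resid_def by (auto intro!: derivative_eq_intros)
  qed
  have "((\<lambda>s. risk_grad (\<lambda>_. 0) K d M p (\<theta>(a := s)) b) has_field_derivative
      (\<Sum>l<M. loss_hess K d \<theta> (p l) a b) / real M) (at (\<theta> a))"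
    unfolding risk_grad_def
  proof (intro DERIV_cdivide DERIV_sum)
    fix l assume "l \<in> {..<M}"
    then have l: "l < M" by simp
    from DERIV_mult'[OF res[OF l] net_grad_has_derivative[OF b a, of \<theta> "snd (p l)"]] nz[OF l]
    show "((\<lambda>s. resid K d (\<theta>(a := s)) (p l) * net_grad (\<lambda>_. 0) d (\<theta>(a := s)) (snd (p l)) b)
        has_field_derivative loss_hess K d \<theta> (p l) a b) (at (\<theta> a))"
      by (simp add: loss_hess_def add.commute)
  qed
  then have "((\<lambda>s. pd (risk K d M p) b (\<theta>(a := s))) has_field_derivative
      (\<Sum>l<M. loss_hess K d \<theta> (p l) a b) / real M) (at (\<theta> a))"
    by (subst DERIV_cong_ev[OF refl ev refl])
  then show ?thesis unfolding hess_def by (rule pd_eqI)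
qed

section \<open>Measurability of derivatives\<close>

text \<open>One direction approximates a zero by rationals, with the endpoints added because an
  interval may degenerate to one irrational point. The other uses compactness: a minimum is
  attained, and it is 0 if values come arbitrarily close to 0.\<close>

lemma continuous_zero_iff_countable:
  fixes \<phi> :: "real \<Rightarrow> real"
  assumes cont: "continuous_on UNIV \<phi>" and nn: "\<And>s. 0 \<le> \<phi> s"
  shows "(\<exists>s\<in>{a..b}. \<phi> s = 0) \<longleftrightarrow>
    (\<forall>q. \<exists>s\<in>(\<rat> \<inter> {a..b}) \<union> ({a, b} \<inter> {a..b}). \<phi> s < inverse (real (Suc q)))"
proof
  assume "\<exists>s\<in>{a..b}. \<phi> s = 0"
  then obtain s where s: "a \<le> s" "s \<le> b" "\<phi> s = 0" by auto
  show "\<forall>q. \<exists>s\<in>(\<rat> \<inter> {a..b}) \<union> ({a, b} \<inter> {a..b}). \<phi> s < inverse (real (Suc q))"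
  proof
    fix q
    show "\<exists>s\<in>(\<rat> \<inter> {a..b}) \<union> ({a, b} \<inter> {a..b}). \<phi> s < inverse (real (Suc q))"
    proof (cases "s = a \<or> s = b")
      case True
      then show ?thesis using s by (intro bexI[of _ s]) auto
    next
      case False
      have "isCont \<phi> s" using cont by (simp add: continuous_on_eq_continuous_at)
      then have "\<forall>\<^sub>F x in at s. \<phi> x < inverse (real (Suc q))"
        unfolding isCont_def using s by (intro order_tendstoD(2)) auto
      then obtain e where e: "e > 0" "\<And>x. x \<noteq> s \<Longrightarrow> dist x s < e \<Longrightarrow> \<phi> x < inverse (real (Suc q))"
        unfolding eventually_at by blast
      obtain r where r: "r \<in> \<rat>" "s < r" "r < min b (s + e)"
        using Rats_dense_in_real[of s "min b (s + e)"] s False e by auto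
      then show ?thesis using s e by (intro bexI[of _ r]) (auto simp: dist_real_def)
    qed
  qed
next
  assume *: "\<forall>q. \<exists>s\<in>(\<rat> \<inter> {a..b}) \<union> ({a, b} \<inter> {a..b}). \<phi> s < inverse (real (Suc q))"
  then have "{a..b} \<noteq> {}" by blast
  then obtain m where m: "m \<in> {a..b}" "\<And>s. s \<in> {a..b} \<Longrightarrow> \<phi> m \<le> \<phi> s"
    using continuous_attains_inf[of "{a..b}" \<phi>] cont continuous_on_subset by blast
  have "\<phi> m \<le> 0"
  proof (rule ccontr)
    assume "\<not> \<phi> m \<le> 0"
    then obtain q where "inverse (real (Suc q)) < \<phi> m" using reals_Archimedean[of "\<phi> m"] by auto
    moreover obtain s where "s \<in> {a..b}" "\<phi> s < inverse (real (Suc q))" using * by blast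
    ultimately show False using m(2) by fastforce
  qed
  then show "\<exists>s\<in>{a..b}. \<phi> s = 0" using m(1) nn[of m] by (intro bexI[of _ m]) auto
qed

definition caratheodory :: "'w measure \<Rightarrow> ('w \<Rightarrow> real \<Rightarrow> real) \<Rightarrow> bool" where
  "caratheodory M F \<longleftrightarrow> (\<forall>\<omega>. continuous_on UNIV (F \<omega>)) \<and> (\<forall>s. (\<lambda>\<omega>. F \<omega> s) \<in> borel_measurable M)"

lemma caratheodory_cont: "caratheodory M F \<Longrightarrow> continuous_on UNIV (F \<omega>)"
  and caratheodory_meas: "caratheodory M F \<Longrightarrow> (\<lambda>\<omega>. F \<omega> s) \<in> borel_measurable M"
  by (simp_all add: caratheodory_def)

lemma caratheodory_zero_measurable:
  assumes F: "caratheodory M F" and nn: "\<And>\<omega> s. 0 \<le> F \<omega> s"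
  shows "{\<omega> \<in> space M. \<exists>s\<in>{a..b}. F \<omega> s = 0} \<in> sets M"
proof -
  have [measurable]: "(\<lambda>\<omega>. F \<omega> s) \<in> borel_measurable M" for s using F by (rule caratheodory_meas)
  have "countable ((\<rat> \<inter> {a..b}) \<union> ({a, b} \<inter> {a..b}))"
    by (auto intro: countable_subset[OF _ countable_rat])
  then have "{\<omega> \<in> space M. \<forall>q. \<exists>s\<in>(\<rat> \<inter> {a..b}) \<union> ({a, b} \<inter> {a..b}). F \<omega> s < inverse (real (Suc q))}
      \<in> sets M"
    by (intro sets.sets_Collect_countable_All sets.sets_Collect_countable_Ex') measurable
  then show ?thesis
    using continuous_zero_iff_countable[OF caratheodory_cont[OF F] nn] by simp
qed

text \<open>The exceptional set is a countable union of projections of sets that are compact in s; this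
  avoids the measurable projection theorem, which would only give analytic sets.\<close>

lemma caratheodory_eventually_right:
  assumes D: "caratheodory M D" and G: "caratheodory M G1" "caratheodory M G2"
  shows "{\<omega> \<in> space M. \<forall>\<^sub>F s in at_right s0.
    (if D \<omega> s = 0 then G1 \<omega> s else G2 \<omega> s) \<le> 0} \<in> sets M"
proof -
  \<comment> \<open>Sums of nonnegative terms encode conjunction and products encode disjunction:
    \<open>F k\<close> vanishes exactly where the inequality is violated with margin
    \<open>inverse (real (Suc k))\<close>. The margin replaces the open conditions D nonzero and G
    positive by closed ones.\<close>
  define F where "F = (\<lambda>k \<omega> s. (\<bar>D \<omega> s\<bar> + max (inverse (real (Suc k)) - G1 \<omega> s) 0)
    * (max (inverse (real (Suc k)) - \<bar>D \<omega> s\<bar>) 0 + max (inverse (real (Suc k)) - G2 \<omega> s) 0))"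
  note cont = caratheodory_cont[OF D] caratheodory_cont[OF G(1)] caratheodory_cont[OF G(2)]
  note [measurable] = caratheodory_meas[OF D] caratheodory_meas[OF G(1)] caratheodory_meas[OF G(2)]
  have F: "caratheodory M (F k)" for k
    unfolding caratheodory_def F_def by (intro conjI allI continuous_intros cont; measurable)
  have nn: "0 \<le> F k \<omega> s" for k \<omega> s unfolding F_def by (intro mult_nonneg_nonneg add_nonneg_nonneg) auto
  \<comment> \<open>For fixed \<open>n\<close> these compact intervals, empty for small
    \<open>k\<close>, exhaust the open interval to the right of \<open>s0\<close> of length
    \<open>inverse (real (Suc n))\<close>.\<close>
  let ?I = "\<lambda>n k. {s0 + inverse (real (Suc k)) .. s0 + inverse (real (Suc n)) - inverse (real (Suc k))}"
  have F0: "F k \<omega> s = 0 \<longleftrightarrow> D \<omega> s = 0 \<and> inverse (real (Suc k)) \<le> G1 \<omega> s \<or>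
      inverse (real (Suc k)) \<le> \<bar>D \<omega> s\<bar> \<and> inverse (real (Suc k)) \<le> G2 \<omega> s" for k \<omega> s
    unfolding F_def by (auto simp: add_nonneg_eq_0_iff max_def simp del: of_nat_Suc split: if_splits)
  have eq: "(\<forall>\<^sub>F s in at_right s0. (if D \<omega> s = 0 then G1 \<omega> s else G2 \<omega> s) \<le> 0) \<longleftrightarrow>
      (\<exists>n. \<forall>k. \<not> (\<exists>s\<in>?I n k. F k \<omega> s = 0))" (is "?L \<longleftrightarrow> ?R") for \<omega>
  proof
    assume ?L
    then obtain b where b: "b > s0" "\<And>s. s0 < s \<Longrightarrow> s < b \<Longrightarrow> (if D \<omega> s = 0 then G1 \<omega> s else G2 \<omega> s) \<le> 0"
      unfolding eventually_at_right_field by blast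
    obtain n where n: "inverse (real (Suc n)) < b - s0" using b reals_Archimedean[of "b - s0"] by auto
    have "F k \<omega> s \<noteq> 0" if "s \<in> ?I n k" for k s
    proof -
      have pos: "0 < inverse (real (Suc k))" by simp
      with that n have "s0 < s" "s < b" unfolding atLeastAtMost_iff by linarith+
      from b(2)[OF this] show ?thesis
        unfolding F0 using pos by (auto simp del: of_nat_Suc inverse_positive_iff_positive split: if_splits)
    qed
    then show ?R by blast
  next
    assume ?R
    then obtain n where n: "\<And>k s. s \<in> ?I n k \<Longrightarrow> F k \<omega> s \<noteq> 0" by blast
    show ?L unfolding eventually_at_right_field
    proof (intro exI[of _ "s0 + inverse (real (Suc n))"] conjI allI impI)
      fix s assume s: "s0 < s" "s < s0 + inverse (real (Suc n))"
      show "(if D \<omega> s = 0 then G1 \<omega> s else G2 \<omega> s) \<le> 0"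
      proof (rule ccontr)
        assume bad: "\<not> (if D \<omega> s = 0 then G1 \<omega> s else G2 \<omega> s) \<le> 0"
        \<comment> \<open>The smallest margin of the violation at \<open>s\<close>: distances to
          both ends, size of \<open>D\<close>, size of the active \<open>G\<close>. The value 1
          stands in for the condition on \<open>\<bar>D \<omega> s\<bar>\<close> when
          \<open>D\<close> vanishes.\<close>
        define e where "e = Min {s - s0, s0 + inverse (real (Suc n)) - s,
          if D \<omega> s = 0 then 1 else \<bar>D \<omega> s\<bar>, if D \<omega> s = 0 then G1 \<omega> s else G2 \<omega> s}"
        have "0 < e" using s bad unfolding e_def by (subst Min_gr_iff) auto
        then obtain k where k: "inverse (real (Suc k)) < e" using reals_Archimedean by blast
        have "s \<in> ?I n k" using k unfolding e_def by (subst (asm) Min_gr_iff) auto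
        moreover have "F k \<omega> s = 0"
          using k unfolding e_def F0 by (subst (asm) Min_gr_iff) (auto split: if_splits)
        ultimately show False using n by blast
      qed
    qed simp
  qed
  have [measurable]: "{\<omega> \<in> space M. \<exists>s\<in>?I n k. F k \<omega> s = 0} \<in> sets M" for n k
    by (rule caratheodory_zero_measurable[OF F nn])
  show ?thesis unfolding eq
    by (intro sets.sets_Collect_countable_Ex sets.sets_Collect_countable_All sets.sets_Collect_neg) measurable
qed

lemma caratheodory_uminus: "caratheodory M F \<Longrightarrow> caratheodory M (\<lambda>\<omega> s. F \<omega> (- s))"
  unfolding caratheodory_def
  by (auto intro!: continuous_on_compose2[of UNIV _ UNIV uminus] continuous_intros)

lemma caratheodory_eventually_left:
  assumes D: "caratheodory M D" and G: "caratheodory M G1" "caratheodory M G2"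
  shows "{\<omega> \<in> space M. \<forall>\<^sub>F s in at_left s0.
    (if D \<omega> s = 0 then G1 \<omega> s else G2 \<omega> s) \<le> 0} \<in> sets M"
  unfolding eventually_at_left_to_right
  by (rule caratheodory_eventually_right[OF caratheodory_uminus[OF D]
      caratheodory_uminus[OF G(1)] caratheodory_uminus[OF G(2)]])

section \<open>Measurable differentiability tests\<close>

text \<open>Clearing the denominator of the difference quotient and letting epsilon run through
  \<open>inverse (real (Suc k))\<close> gives countably many inequalities of the form accepted by
  the one-sided measurability lemmas.\<close>

lemma has_derivative_iff_eventually_le:
  fixes f :: "real \<Rightarrow> real"
  shows "(f has_field_derivative L) (at s0) \<longleftrightarrow>
    (\<forall>k. \<forall>\<^sub>F s in at s0. \<bar>f s - f s0 - L * (s - s0)\<bar> - inverse (real (Suc k)) * \<bar>s - s0\<bar> \<le> 0)"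
    (is "?L \<longleftrightarrow> ?R")
proof -
  have q: "\<bar>(f s - f s0) / (s - s0) - L\<bar> = \<bar>f s - f s0 - L * (s - s0)\<bar> / \<bar>s - s0\<bar>" if "s \<noteq> s0" for s
    using that by (simp add: abs_divide[symmetric] diff_divide_distrib)
  show ?thesis
  proof
    assume ?L
    show ?R
    proof
      fix k
      have "\<forall>\<^sub>F s in at s0. dist ((f s - f s0) / (s - s0)) L < inverse (real (Suc k))"
        using \<open>?L\<close> unfolding has_field_derivative_iff by (rule tendstoD) simp
      moreover have "\<forall>\<^sub>F s in at s0. s \<noteq> s0" by (simp add: eventually_at_filter)
      ultimately show "\<forall>\<^sub>F s in at s0. \<bar>f s - f s0 - L * (s - s0)\<bar> - inverse (real (Suc k)) * \<bar>s - s0\<bar> \<le> 0"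
        by eventually_elim (simp add: dist_real_def q pos_divide_less_eq del: of_nat_Suc)
    qed
  next
    assume ?R
    show ?L unfolding has_field_derivative_iff
    proof (rule tendstoI)
      fix e :: real assume "e > 0"
      then obtain k where k: "inverse (real (Suc k)) < e" using reals_Archimedean by blast
      have "\<forall>\<^sub>F s in at s0. s \<noteq> s0" by (simp add: eventually_at_filter)
      moreover have "\<forall>\<^sub>F s in at s0.
          \<bar>f s - f s0 - L * (s - s0)\<bar> - inverse (real (Suc k)) * \<bar>s - s0\<bar> \<le> 0"
        using \<open>?R\<close> by blast
      ultimately show "\<forall>\<^sub>F s in at s0. dist ((f s - f s0) / (s - s0)) L < e"
      proof eventually_elim
        case (elim s)
        then have "\<bar>(f s - f s0) / (s - s0) - L\<bar> \<le> inverse (real (Suc k))"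
          by (simp add: q pos_divide_le_eq del: of_nat_Suc)
        with k show ?case by (simp add: dist_real_def)
      qed
    qed
  qed
qed

text \<open>\<open>f\<close> may jump in \<open>s\<close>; all that is asked is the shape that
  \<open>pd_risk\<close> produces, a continuous piece on a zero set and 0 off it, with separate
  pieces on the two sides. Substituting the pieces turns differentiability into conditions on
  functions that are continuous in \<open>s\<close>.\<close>

lemma measurable_deriv_piecewise:
  fixes f :: "'w \<Rightarrow> real \<Rightarrow> real"
  assumes f[measurable]: "\<And>s. (\<lambda>\<omega>. f \<omega> s) \<in> borel_measurable M"
    and right: "\<And>\<omega>. \<forall>\<^sub>F s in at_right s0. f \<omega> s = (if D \<omega> s = 0 then R \<omega> s else 0)"
    and left: "\<And>\<omega>. \<forall>\<^sub>F s in at_left s0. f \<omega> s = (if D' \<omega> s = 0 then R' \<omega> s else 0)"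
    and C: "caratheodory M D" "caratheodory M R" "caratheodory M D'" "caratheodory M R'"
  shows "(\<lambda>\<omega>. if f \<omega> differentiable (at s0) then deriv (f \<omega>) s0 else 0) \<in> borel_measurable M"
proof -
  \<comment> \<open>A derivative at \<open>s0\<close>, if there is one, is the limit along this
    sequence, so a single measurable candidate suffices. Its value where the sequence diverges is
    harmless because differentiability is tested separately.\<close>
  define L where "L = (\<lambda>\<omega>. lim (\<lambda>n. (f \<omega> (s0 + inverse (real (Suc n))) - f \<omega> s0) / inverse (real (Suc n))))"
  have L[measurable]: "L \<in> borel_measurable M"
    unfolding L_def by (intro borel_measurable_lim_metric) measurable
  have L_eq: "l = L \<omega>" if "(f \<omega> has_field_derivative l) (at s0)" for \<omega> l
  proof -
    have "filterlim (\<lambda>n. s0 + inverse (real (Suc n))) (at s0) sequentially"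
      unfolding filterlim_at using LIMSEQ_inverse_real_of_nat_add by simp
    from filterlim_compose[OF that[unfolded has_field_derivative_iff] this]
    show ?thesis unfolding L_def by (simp add: limI)
  qed
  define G where "G = (\<lambda>H k \<omega> s. \<bar>H \<omega> s - f \<omega> s0 - L \<omega> * (s - s0)\<bar> - inverse (real (Suc k)) * \<bar>s - s0\<bar>)"
  have G: "caratheodory M (G H k)" if "caratheodory M H" for H k
  proof -
    note cont = caratheodory_cont[OF that]
    note [measurable] = caratheodory_meas[OF that]
    show ?thesis
      unfolding caratheodory_def G_def by (intro conjI allI continuous_intros cont; measurable)
  qed
  have z: "caratheodory M (\<lambda>_ _. 0)" by (simp add: caratheodory_def)
  have A: "(f \<omega> has_field_derivative L \<omega>) (at s0) \<longleftrightarrow>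
    (\<forall>k. (\<forall>\<^sub>F s in at_left s0. (if D' \<omega> s = 0 then G R' k \<omega> s else G (\<lambda>_ _. 0) k \<omega> s) \<le> 0) \<and>
      (\<forall>\<^sub>F s in at_right s0. (if D \<omega> s = 0 then G R k \<omega> s else G (\<lambda>_ _. 0) k \<omega> s) \<le> 0))" for \<omega>
  proof -
    have "(\<forall>\<^sub>F s in at_left s0. \<bar>f \<omega> s - f \<omega> s0 - L \<omega> * (s - s0)\<bar> - inverse (real (Suc k)) * \<bar>s - s0\<bar> \<le> 0)
        \<longleftrightarrow> (\<forall>\<^sub>F s in at_left s0. (if D' \<omega> s = 0 then G R' k \<omega> s else G (\<lambda>_ _. 0) k \<omega> s) \<le> 0)" for k
      by (rule eventually_cong[OF left[of \<omega>]]) (simp add: G_def)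
    moreover have "(\<forall>\<^sub>F s in at_right s0. \<bar>f \<omega> s - f \<omega> s0 - L \<omega> * (s - s0)\<bar> - inverse (real (Suc k)) * \<bar>s - s0\<bar> \<le> 0)
        \<longleftrightarrow> (\<forall>\<^sub>F s in at_right s0. (if D \<omega> s = 0 then G R k \<omega> s else G (\<lambda>_ _. 0) k \<omega> s) \<le> 0)" for k
      by (rule eventually_cong[OF right[of \<omega>]]) (simp add: G_def)
    ultimately show ?thesis
      unfolding has_derivative_iff_eventually_le eventually_at_split by simp
  qed
  have S: "{\<omega> \<in> space M. (f \<omega> has_field_derivative L \<omega>) (at s0)} \<in> sets M"
    unfolding A
    by (intro sets.sets_Collect_countable_All sets.sets_Collect_conj caratheodory_eventually_left
        caratheodory_eventually_right C G z)
  have "(if f \<omega> differentiable (at s0) then deriv (f \<omega>) s0 else 0) =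
      (if (f \<omega> has_field_derivative L \<omega>) (at s0) then L \<omega> else 0)" for \<omega>
    by (metis L_eq real_differentiable_def DERIV_imp_deriv)
  then show ?thesis using S by (simp add: measurable_If)
qed

section \<open>Measurability of the empirical Hessian\<close>

lemma par_idx_cases:
  assumes "a \<in> par_idx K d"
  obtains i where "a = Inl i" "i < K" | i j where "a = Inr (i, j)" "i < K" "j < d"
  using assms by (auto simp: par_idx_def)

lemma measurable_relu [measurable]: "relu \<in> borel_measurable borel"
  unfolding relu_def by measurable

lemma measurable_sigmoid [measurable]: "sigmoid \<in> borel_measurable borel"
  unfolding sigmoid_def by measurable

lemma measurable_relu_slope:
  assumes [measurable]: "m \<in> borel_measurable borel" "U \<in> borel_measurable M" "X \<in> borel_measurable M"
  shows "(\<lambda>\<omega>. relu_slope m (U \<omega>) (X \<omega>)) \<in> borel_measurable M"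
  unfolding relu_slope_def by measurable

context
  fixes M :: "'w measure" and d :: nat and q :: "'w \<Rightarrow> real \<times> (nat \<Rightarrow> real)"
  assumes fst_q [measurable]: "(\<lambda>\<omega>. fst (q \<omega>)) \<in> borel_measurable M"
    and snd_q [measurable]: "\<And>j. j < d \<Longrightarrow> (\<lambda>\<omega>. snd (q \<omega>) j) \<in> borel_measurable M"
begin

lemma measurable_pre: "(\<lambda>\<omega>. pre d \<theta> i (snd (q \<omega>))) \<in> borel_measurable M"
  unfolding pre_def by measurable

lemma measurable_net: "(\<lambda>\<omega>. net K d \<theta> (snd (q \<omega>))) \<in> borel_measurable M"
  using measurable_pre[measurable] unfolding net_pre by measurable

lemma measurable_resid: "(\<lambda>\<omega>. resid K d \<theta> (q \<omega>)) \<in> borel_measurable M"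
  using measurable_net[measurable] unfolding resid_def by measurable

lemma measurable_net_grad:
  assumes "a \<in> par_idx K d" "m \<in> borel_measurable borel"
  shows "(\<lambda>\<omega>. net_grad m d \<theta> (snd (q \<omega>)) a) \<in> borel_measurable M"
  using assms(1)
proof (cases rule: par_idx_cases)
  case (1 i)
  then show ?thesis using measurable_pre[measurable] by (simp add: net_grad_def)
next
  case (2 i j)
  then show ?thesis
    by (auto simp: net_grad_def
        intro!: borel_measurable_times measurable_relu_slope measurable_pre snd_q assms(2))
qed

lemma measurable_net_hess:
  assumes "a \<in> par_idx K d" "b \<in> par_idx K d"
  shows "(\<lambda>\<omega>. net_hess d \<theta> (snd (q \<omega>)) a b) \<in> borel_measurable M"
  using assms(1)
proof (cases rule: par_idx_cases)
  case a: (1 i)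
  show ?thesis using assms(2)
  proof (cases rule: par_idx_cases)
    case (2 k j)
    then show ?thesis
      by (cases "i = k") (auto simp: a net_hess_def intro!: measurable_relu_slope measurable_pre snd_q)
  qed (simp add: a net_hess_def)
next
  case a: (2 k j)
  show ?thesis using assms(2)
  proof (cases rule: par_idx_cases)
    case (1 i)
    then show ?thesis using a
      by (cases "i = k") (auto simp: net_hess_def intro!: measurable_relu_slope measurable_pre snd_q)
  qed (simp add: a net_hess_def)
qed

lemma measurable_loss_hess:
  assumes "a \<in> par_idx K d" "b \<in> par_idx K d"
  shows "(\<lambda>\<omega>. loss_hess K d \<theta> (q \<omega>) a b) \<in> borel_measurable M"
proof -
  note [measurable] = measurable_net_hess[OF assms] measurable_net measurable_resid
    measurable_net_grad[OF assms(1)] measurable_net_grad[OF assms(2)]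
  show ?thesis unfolding loss_hess_def by measurable
qed

end

lemma measurable_risk_grad:
  assumes b: "b \<in> par_idx K d" and m: "m \<in> borel_measurable borel"
    and p: "\<And>l. l < n \<Longrightarrow> (\<lambda>\<omega>. fst (p \<omega> l)) \<in> borel_measurable M"
      "\<And>l j. l < n \<Longrightarrow> j < d \<Longrightarrow> (\<lambda>\<omega>. snd (p \<omega> l) j) \<in> borel_measurable M"
  shows "(\<lambda>\<omega>. risk_grad m K d n (p \<omega>) \<theta> b) \<in> borel_measurable M"
  unfolding risk_grad_def
  by (intro borel_measurable_divide borel_measurable_sum borel_measurable_times
      measurable_resid measurable_net_grad[OF _ _ b m] p) auto

section \<open>One-sided gradients along a coordinate line\<close>

lemma continuous_relu: "continuous_on A f \<Longrightarrow> continuous_on A (\<lambda>s. relu (f s))" for f :: "real \<Rightarrow> real"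
  unfolding relu_def by (intro continuous_intros)

lemma continuous_pre_upd: "continuous_on UNIV (\<lambda>s. pre d (\<theta>(a := s)) i Y)"
  unfolding pre_upd by (intro continuous_intros)

lemma continuous_upd: "continuous_on UNIV (\<lambda>s::real. (\<theta>(a := s)) c)"
  by (cases "a = c") (auto intro: continuous_intros)

lemma continuous_resid_upd: "continuous_on UNIV (\<lambda>s. resid K d (\<theta>(a := s)) p)"
proof -
  have pos: "1 + exp z \<noteq> 0" for z :: real by (metis add_pos_pos exp_gt_zero less_irrefl zero_less_one)
  show ?thesis unfolding resid_def sigmoid_def net_pre
    by (intro continuous_intros continuous_relu continuous_pre_upd continuous_upd ballI pos)
qed

text \<open>Along a coordinate line through a parameter, the signs of the preactivations are constant on
  either side; at a vanishing preactivation the sign is that of sg times its slope, sg = 1 on the right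
  and sg = -1 on the left.\<close>
definition side_grad :: "real \<Rightarrow> (real \<Rightarrow> real) \<Rightarrow> nat \<Rightarrow> (nat + nat \<times> nat \<Rightarrow> real)
    \<Rightarrow> nat + nat \<times> nat \<Rightarrow> (nat \<Rightarrow> real) \<Rightarrow> nat + nat \<times> nat \<Rightarrow> real \<Rightarrow> real" where
  "side_grad sg m d \<theta> a Y b s = (case b of Inl i \<Rightarrow> relu (pre d (\<theta>(a := s)) i Y)
     | Inr (i, j) \<Rightarrow> (\<theta>(a := s)) (Inl i) *
         relu_slope m (if pre d \<theta> i Y = 0 then sg * pre_dir d a i Y else pre d \<theta> i Y) (Y j))"

lemma eventually_side_grad:
  assumes sg: "\<And>s. s \<in> S \<Longrightarrow> sgn (s - \<theta> a) = sg"
  shows "\<forall>\<^sub>F s in at (\<theta> a) within S. net_grad m d (\<theta>(a := s)) Y b = side_grad sg m d \<theta> a Y b s"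
proof (cases b)
  case (Inl i)
  then show ?thesis by (simp add: net_grad_def side_grad_def)
next
  case (Inr q)
  obtain i j where b: "b = Inr (i, j)" using Inr by (cases q) auto
  have inS: "\<forall>\<^sub>F s in at (\<theta> a) within S. s \<in> S" by (simp add: eventually_at_filter)
  have "\<forall>\<^sub>F s in at (\<theta> a) within S. sgn (pre d (\<theta>(a := s)) i Y) =
      sgn (if pre d \<theta> i Y = 0 then sg * pre_dir d a i Y else pre d \<theta> i Y)"
  proof (cases "pre d \<theta> i Y = 0")
    case True
    from inS show ?thesis
    proof eventually_elim
      case (elim s)
      have "sgn sg = sg" using sg[OF elim] by (metis sgn_sgn)
      then show ?case using True sg[OF elim] by (simp add: pre_upd sgn_mult)
    qed
  next
    case False
    then show ?thesis
      using filter_leD[OF at_within_le_nhds eventually_pre_upd[OF False]] by simp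
  qed
  then show ?thesis
  proof eventually_elim
    case (elim s)
    show ?case unfolding b net_grad_def side_grad_def sum.case prod.case
      by (rule arg_cong[OF relu_slope_sgn[OF elim]])
  qed
qed

text \<open>In \<open>side_grad\<close> the sign passed to \<open>relu_slope\<close> is computed at
  the base point and does not move with \<open>s\<close>. This removes the jumps of
  \<open>net_grad\<close>, and \<open>s\<close> enters through continuous factors only.\<close>

lemma caratheodory_side_grad:
  assumes b: "b \<in> par_idx K d" and m: "m \<in> borel_measurable borel"
    and p: "\<And>l. l < n \<Longrightarrow> (\<lambda>\<omega>. fst (p \<omega> l)) \<in> borel_measurable M"
      "\<And>l j. l < n \<Longrightarrow> j < d \<Longrightarrow> (\<lambda>\<omega>. snd (p \<omega> l) j) \<in> borel_measurable M"
  shows "caratheodory M (\<lambda>\<omega> s. (\<Sum>l<n. resid K d (\<theta>(a := s)) (p \<omega> l) *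
    side_grad sg m d \<theta> a (snd (p \<omega> l)) b s) / real n)"
  unfolding caratheodory_def
proof (intro conjI allI)
  show "continuous_on UNIV (\<lambda>s. (\<Sum>l<n. resid K d (\<theta>(a := s)) (p \<omega> l) *
      side_grad sg m d \<theta> a (snd (p \<omega> l)) b s) / real n)" for \<omega>
  proof -
    have "continuous_on UNIV (side_grad sg m d \<theta> a Y b)" for Y
      unfolding side_grad_def
      by (cases b) (auto intro!: continuous_intros continuous_relu continuous_pre_upd continuous_upd
          simp del: fun_upd_apply split: prod.split)
    then have "continuous_on UNIV (\<lambda>s. side_grad sg m d \<theta> a Y b s)" for Y by simp
    then show ?thesis
      unfolding divide_inverse by (intro continuous_intros continuous_resid_upd)
  qed
  fix s
  have dir: "(\<lambda>\<omega>. pre_dir d a i (snd (p \<omega> l))) \<in> borel_measurable M" if "l < n" for l i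
  proof (cases "\<exists>j<d. a = Inr (i, j)")
    case True
    then show ?thesis using p(2)[OF that] by auto
  next
    case False
    then have "pre_dir d a i Y = 0" for Y by (auto split: sum.splits)
    then show ?thesis by simp
  qed
  have "(\<lambda>\<omega>. side_grad sg m d \<theta> a (snd (p \<omega> l)) b s) \<in> borel_measurable M" if l: "l < n" for l
    using b
  proof (cases rule: par_idx_cases)
    case (1 i)
    then show ?thesis
      using measurable_pre[OF p[OF l]] by (simp add: side_grad_def del: fun_upd_apply)
  next
    case (2 i j)
    note [measurable] = dir[OF l, of i] measurable_pre[OF p[OF l], where \<theta> = \<theta> and i = i] p(2)[OF l \<open>j < d\<close>] m
    have "(\<lambda>\<omega>. if pre d \<theta> i (snd (p \<omega> l)) = 0 then sg * pre_dir d a i (snd (p \<omega> l))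
        else pre d \<theta> i (snd (p \<omega> l))) \<in> borel_measurable M" by measurable
    from measurable_relu_slope[OF m this p(2)[OF l \<open>j < d\<close>]] show ?thesis
      unfolding side_grad_def 2 sum.case prod.case by measurable
  qed
  then show "(\<lambda>\<omega>. (\<Sum>l<n. resid K d (\<theta>(a := s)) (p \<omega> l) *
      side_grad sg m d \<theta> a (snd (p \<omega> l)) b s) / real n) \<in> borel_measurable M"
    by (intro borel_measurable_divide borel_measurable_sum borel_measurable_times
        measurable_resid p) auto
qed

lemma caratheodory_diff: "caratheodory M F \<Longrightarrow> caratheodory M G \<Longrightarrow> caratheodory M (\<lambda>\<omega> s. F \<omega> s - G \<omega> s)"
  unfolding caratheodory_def by (auto intro!: continuous_intros borel_measurable_diff)

text \<open>On each side of \<open>\<theta> a\<close>, \<open>pd_risk\<close> with frozen signs is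
  the right-derivative expression where it agrees with the left-derivative one and 0 elsewhere.
  Their difference is the switching function for \<open>measurable_deriv_piecewise\<close>.\<close>

lemma measurable_hess_risk:
  assumes a: "a \<in> par_idx K d" and b: "b \<in> par_idx K d"
    and p: "\<And>l. l < n \<Longrightarrow> (\<lambda>\<omega>. fst (p \<omega> l)) \<in> borel_measurable M"
      "\<And>l j. l < n \<Longrightarrow> j < d \<Longrightarrow> (\<lambda>\<omega>. snd (p \<omega> l) j) \<in> borel_measurable M"
  shows "(\<lambda>\<omega>. hess (risk K d n (p \<omega>)) \<theta> a b) \<in> borel_measurable M"
proof -
  let ?max = "\<lambda>x::real. max x 0" and ?min = "\<lambda>x::real. min x 0"
  define g where "g = (\<lambda>sg m \<omega> s. (\<Sum>l<n. resid K d (\<theta>(a := s)) (p \<omega> l) *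
    side_grad sg m d \<theta> a (snd (p \<omega> l)) b s) / real n)"
  have C: "caratheodory M (g sg ?max)" "caratheodory M (g sg ?min)" for sg
    unfolding g_def by (intro caratheodory_side_grad b p; measurable)+
  have grad: "\<forall>\<^sub>F s in at (\<theta> a) within S. risk_grad m K d n (p \<omega>) (\<theta>(a := s)) b = g sg m \<omega> s"
    if "\<And>s. s \<in> S \<Longrightarrow> sgn (s - \<theta> a) = sg" for S sg m \<omega>
  proof -
    have "\<forall>\<^sub>F s in at (\<theta> a) within S. \<forall>l\<in>{..<n}.
        net_grad m d (\<theta>(a := s)) (snd (p \<omega> l)) b = side_grad sg m d \<theta> a (snd (p \<omega> l)) b s"
      using that by (intro eventually_ball_finite ballI eventually_side_grad) auto
    then show ?thesis by eventually_elim (simp add: risk_grad_def g_def)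
  qed
  have side: "\<forall>\<^sub>F s in at (\<theta> a) within S. pd (risk K d n (p \<omega>)) b (\<theta>(a := s)) =
      (if g sg ?max \<omega> s - g sg ?min \<omega> s = 0 then g sg ?max \<omega> s else 0)"
    if "\<And>s. s \<in> S \<Longrightarrow> sgn (s - \<theta> a) = sg" for S sg \<omega>
  proof -
    have "\<forall>\<^sub>F s in at (\<theta> a) within S. risk_grad ?max K d n (p \<omega>) (\<theta>(a := s)) b = g sg ?max \<omega> s"
      "\<forall>\<^sub>F s in at (\<theta> a) within S. risk_grad ?min K d n (p \<omega>) (\<theta>(a := s)) b = g sg ?min \<omega> s"
      using that by (auto intro: grad)
    then show ?thesis by eventually_elim (simp add: pd_risk[OF b])
  qed
  have "(\<lambda>\<omega>. if (\<lambda>s. pd (risk K d n (p \<omega>)) b (\<theta>(a := s))) differentiable (at (\<theta> a))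
      then deriv (\<lambda>s. pd (risk K d n (p \<omega>)) b (\<theta>(a := s))) (\<theta> a) else 0) \<in> borel_measurable M"
  proof (rule measurable_deriv_piecewise)
    fix s
    have [measurable]: "(\<lambda>\<omega>. risk_grad ?max K d n (p \<omega>) (\<theta>(a := s)) b) \<in> borel_measurable M"
      "(\<lambda>\<omega>. risk_grad ?min K d n (p \<omega>) (\<theta>(a := s)) b) \<in> borel_measurable M"
      by (intro measurable_risk_grad b p; measurable)+
    show "(\<lambda>\<omega>. pd (risk K d n (p \<omega>)) b (\<theta>(a := s))) \<in> borel_measurable M"
      unfolding pd_risk[OF b] by measurable
  next
    show "\<forall>\<^sub>F s in at_right (\<theta> a). pd (risk K d n (p \<omega>)) b (\<theta>(a := s)) =
      (if g 1 ?max \<omega> s - g 1 ?min \<omega> s = 0 then g 1 ?max \<omega> s else 0)" for \<omega>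
      by (rule side) simp
    show "\<forall>\<^sub>F s in at_left (\<theta> a). pd (risk K d n (p \<omega>)) b (\<theta>(a := s)) =
      (if g (-1) ?max \<omega> s - g (-1) ?min \<omega> s = 0 then g (-1) ?max \<omega> s else 0)" for \<omega>
      by (rule side) simp
  qed (intro caratheodory_diff C)+
  then show ?thesis by (simp add: hess_def pd_def[of "\<lambda>\<theta>'. pd _ _ \<theta>'"])
qed

section \<open>Concentration\<close>

lemma sum_par_idx:
  fixes f :: "nat + nat \<times> nat \<Rightarrow> real"
  shows "(\<Sum>a\<in>par_idx K d. f a) = (\<Sum>i<K. f (Inl i)) + (\<Sum>i<K. \<Sum>j<d. f (Inr (i, j)))"
proof -
  have "(\<Sum>a\<in>par_idx K d. f a) = sum f (Inl ` {..<K}) + sum f (Inr ` ({..<K} \<times> {..<d}))"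
    unfolding par_idx_def by (intro sum.union_disjoint) auto
  then show ?thesis by (simp add: sum.reindex sum.cartesian_product)
qed

lemma finite_par_idx [simp]: "finite (par_idx K d)"
  by (simp add: par_idx_def)

lemma card_par_idx: "card (par_idx K d) = K + K * d"
proof -
  have "card (par_idx K d) = card (Inl ` {..<K} :: (nat + nat \<times> nat) set) +
      card (Inr ` ({..<K} \<times> {..<d}) :: (nat + nat \<times> nat) set)"
    unfolding par_idx_def by (intro card_Un_disjoint) auto
  then show ?thesis by (simp add: card_image)
qed

lemma par_idx_entry_sq_le:
  assumes "(\<Sum>a\<in>par_idx K d. (x a)\<^sup>2) \<le> C" "a \<in> par_idx K d"
  shows "(x a :: real)\<^sup>2 \<le> C"
  using member_le_sum[of a "par_idx K d" "\<lambda>a. (x a)\<^sup>2"] assms by simp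

lemma par_idx_row_sq_le:
  fixes x :: "nat + nat \<times> nat \<Rightarrow> real"
  assumes "(\<Sum>a\<in>par_idx K d. (x a)\<^sup>2) \<le> C" "i < K"
  shows "(\<Sum>j<d. (x (Inr (i, j)))\<^sup>2) \<le> C"
proof -
  have "(\<Sum>j<d. (x (Inr (i, j)))\<^sup>2) \<le> (\<Sum>i<K. \<Sum>j<d. (x (Inr (i, j)))\<^sup>2)"
    using member_le_sum[of i "{..<K}" "\<lambda>i. \<Sum>j<d. (x (Inr (i, j)))\<^sup>2"] assms(2)
    by (simp add: sum_nonneg)
  also have "\<dots> \<le> C"
    using assms(1) by (simp add: sum_par_idx) (smt (verit) sum_nonneg zero_le_power2)
  finally show ?thesis .
qed

lemma relu_slope_zero: "relu_slope (\<lambda>_. 0) u x = of_bool (0 < u) * x"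
  by (simp add: relu_slope_def)

lemma pre_scaled: "(\<Sum>j<d. x (Inr (i, j)) * (c * (e * Y j))) = c * (e * pre d x i Y)"
  by (simp add: pre_def sum_distrib_left mult_ac)

lemma net_grad_form:
  "(\<Sum>a\<in>par_idx K d. x a * net_grad (\<lambda>_. 0) d \<theta> Y a) =
    (\<Sum>i<K. x (Inl i) * relu (pre d \<theta> i Y) + \<theta> (Inl i) * (of_bool (0 < pre d \<theta> i Y) * pre d x i Y))"
  by (simp add: sum_par_idx net_grad_def relu_slope_zero sum.distrib pre_scaled)

lemma net_hess_form:
  "(\<Sum>a\<in>par_idx K d. \<Sum>b\<in>par_idx K d. x a * net_hess d \<theta> Y a b * y b) =
    (\<Sum>i<K. of_bool (0 < pre d \<theta> i Y) * (x (Inl i) * pre d y i Y + y (Inl i) * pre d x i Y))"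
proof -
  have l: "(\<Sum>b\<in>par_idx K d. x (Inl i) * net_hess d \<theta> Y (Inl i) b * y b) =
      of_bool (0 < pre d \<theta> i Y) * (x (Inl i) * pre d y i Y)" if "i < K" for i
  proof -
    have "(\<Sum>b\<in>par_idx K d. x (Inl i) * net_hess d \<theta> Y (Inl i) b * y b) =
      (\<Sum>k<K. \<Sum>j<d. x (Inl i) * (if i = k then relu_slope (\<lambda>_. 0) (pre d \<theta> k Y) (Y j) else 0)
        * y (Inr (k, j)))"
      by (simp add: sum_par_idx net_hess_def)
    also have "\<dots> = (\<Sum>k<K. if k = i then
        \<Sum>j<d. x (Inl i) * (of_bool (0 < pre d \<theta> i Y) * Y j) * y (Inr (i, j)) else 0)"
      by (rule sum.cong) (auto simp: relu_slope_zero)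
    also have "\<dots> = (\<Sum>j<d. x (Inl i) * (of_bool (0 < pre d \<theta> i Y) * Y j) * y (Inr (i, j)))"
      using that by simp
    finally show ?thesis by (simp add: pre_def sum_distrib_left mult_ac)
  qed
  have r: "(\<Sum>b\<in>par_idx K d. x (Inr (i, j)) * net_hess d \<theta> Y (Inr (i, j)) b * y b) =
      of_bool (0 < pre d \<theta> i Y) * (y (Inl i) * (x (Inr (i, j)) * Y j))" if "i < K" for i j
  proof -
    have "(\<Sum>b\<in>par_idx K d. x (Inr (i, j)) * net_hess d \<theta> Y (Inr (i, j)) b * y b) =
      (\<Sum>k<K. x (Inr (i, j)) * (if k = i then relu_slope (\<lambda>_. 0) (pre d \<theta> i Y) (Y j) else 0) * y (Inl k))"
      by (simp add: sum_par_idx net_hess_def)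
    also have "\<dots> =
      (\<Sum>k<K. if k = i then x (Inr (i, j)) * (of_bool (0 < pre d \<theta> i Y) * Y j) * y (Inl i) else 0)"
      by (rule sum.cong) (auto simp: relu_slope_zero)
    also have "\<dots> = x (Inr (i, j)) * (of_bool (0 < pre d \<theta> i Y) * Y j) * y (Inl i)"
      using that by simp
    finally show ?thesis by simp
  qed
  have sc: "(\<Sum>j<d. e * (y (Inl i) * (x (Inr (i, j)) * Y j))) = e * (y (Inl i) * pre d x i Y)" for e i
    by (simp only: pre_def sum_distrib_left)
  have "(\<Sum>a\<in>par_idx K d. \<Sum>b\<in>par_idx K d. x a * net_hess d \<theta> Y a b * y b) =
    (\<Sum>i<K. of_bool (0 < pre d \<theta> i Y) * (x (Inl i) * pre d y i Y)) +
    (\<Sum>i<K. \<Sum>j<d. of_bool (0 < pre d \<theta> i Y) * (y (Inl i) * (x (Inr (i, j)) * Y j)))"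
    by (subst sum_par_idx) (simp add: l r)
  then show ?thesis by (simp add: sc sum.distrib distrib_left)
qed

text \<open>Quadratic envelope of all bilinear forms below: squared projections of the data point onto the
  3 K rows of theta / L, x and y, each of norm at most 1.\<close>
definition envelope :: "nat \<Rightarrow> nat \<Rightarrow> (nat \<Rightarrow> nat + nat \<times> nat \<Rightarrow> real) \<Rightarrow> (nat \<Rightarrow> real) \<Rightarrow> real" where
  "envelope K d u Y = (\<Sum>(k, i)\<in>{..<3::nat} \<times> {..<K}. (pre d (u k) i Y)\<^sup>2)"

definition triple :: "'b \<Rightarrow> 'b \<Rightarrow> 'b \<Rightarrow> nat \<Rightarrow> 'b" where
  "triple x y z k = (if k = 0 then x else if k = 1 then y else z)"

lemma envelope_triple:
  "envelope K d (triple \<theta> x y) Y =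
    (\<Sum>i<K. (pre d \<theta> i Y)\<^sup>2) + (\<Sum>i<K. (pre d x i Y)\<^sup>2) + (\<Sum>i<K. (pre d y i Y)\<^sup>2)"
  unfolding envelope_def sum.cartesian_product[symmetric]
  by (simp add: triple_def numeral_3_eq_3)

text \<open>A sum is at most the number of terms times the largest one. This stands in for
  independence of the projections; the summand 1 covers the empty index set.\<close>

lemma exp_sum_le:
  assumes "finite I" "\<And>i. i \<in> I \<Longrightarrow> (0::real) \<le> f i"
  shows "exp (\<Sum>i\<in>I. f i) \<le> 1 + (\<Sum>i\<in>I. exp (real (card I) * f i))"
proof (cases "I = {}")
  case False
  then have "Max (f ` I) \<in> f ` I" using assms by (intro Max_in) auto
  then obtain i where i: "i \<in> I" "f i = Max (f ` I)" by auto
  have "(\<Sum>j\<in>I. f j) \<le> of_nat (card I) * f i"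
    using assms(1) i by (intro sum_bounded_above) simp
  then have "exp (\<Sum>j\<in>I. f j) \<le> exp (real (card I) * f i)" by simp
  also have "\<dots> \<le> (\<Sum>i\<in>I. exp (real (card I) * f i))"
    using assms(1) i by (intro member_le_sum) auto
  finally show ?thesis by simp
qed simp

lemma exp_moment_envelope:
  fixes A :: real and K :: nat
  defines "s0 \<equiv> 1 / (8 * A * (3 * real K + 1))"
  assumes lam: "1 \<le> lam" and o: "orthonormal2 d \<mu> \<nu>" and A: "0 < A"
    and u: "\<And>k i. k < 3 \<Longrightarrow> i < K \<Longrightarrow> (\<Sum>j<d. (u k (Inr (i, j)))\<^sup>2) \<le> 1"
    and X: "\<And>\<omega>. \<bar>X \<omega>\<bar> \<le> A * (1 + envelope K d u (snd (data_point d \<mu> \<nu> \<omega>)))"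
  shows "(\<integral>\<^sup>+\<omega>. ennreal (exp (s0 * \<bar>X \<omega>\<bar>)) \<partial>point_law d lam)
    \<le> ennreal (exp (s0 * A) * (1 + 3 * real K * (exp (1/4) * sqrt 2)))"
proof -
  interpret prob_space "point_law d lam" using lam by (intro prob_space_point_law) simp
  let ?I = "{..<3::nat} \<times> {..<K}"
  let ?Y = "\<lambda>\<omega>. snd (data_point d \<mu> \<nu> \<omega>)"
  define a where "a = real (card ?I) * (s0 * A)"
  have s0: "0 < s0" using A by (simp add: s0_def)
  have a: "0 \<le> a" "a \<le> 1/8" using A s0 by (auto simp: a_def card_cartesian_product s0_def field_simps)
  have [measurable]: "(\<lambda>\<omega>. pre d \<theta> i (?Y \<omega>)) \<in> borel_measurable (point_law d lam)" for \<theta> i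
    by (intro measurable_pre measurable_data_point)
  have "(\<integral>\<^sup>+\<omega>. ennreal (exp (s0 * \<bar>X \<omega>\<bar>)) \<partial>point_law d lam) \<le>
    (\<integral>\<^sup>+\<omega>. ennreal (exp (s0 * A)) * (1 + (\<Sum>(k, i)\<in>?I. ennreal (exp (a * (pre d (u k) i (?Y \<omega>))\<^sup>2))))
      \<partial>point_law d lam)"
  proof (intro nn_integral_mono)
    fix \<omega>
    have "s0 * \<bar>X \<omega>\<bar> \<le> s0 * (A * (1 + envelope K d u (?Y \<omega>)))"
      using s0 X by (intro mult_left_mono) auto
    also have "\<dots> = s0 * A + (\<Sum>(k, i)\<in>?I. s0 * A * (pre d (u k) i (?Y \<omega>))\<^sup>2)"
      by (simp add: envelope_def algebra_simps sum_distrib_left case_prod_beta)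
    finally have "exp (s0 * \<bar>X \<omega>\<bar>) \<le> exp (s0 * A) * exp (\<Sum>(k, i)\<in>?I. s0 * A * (pre d (u k) i (?Y \<omega>))\<^sup>2)"
      by (simp add: exp_add[symmetric])
    also have "\<dots> \<le> exp (s0 * A) * (1 + (\<Sum>(k, i)\<in>?I. exp (a * (pre d (u k) i (?Y \<omega>))\<^sup>2)))"
    proof (intro mult_left_mono)
      have "exp (\<Sum>q\<in>?I. s0 * A * (pre d (u (fst q)) (snd q) (?Y \<omega>))\<^sup>2) \<le>
        1 + (\<Sum>q\<in>?I. exp (real (card ?I) * (s0 * A * (pre d (u (fst q)) (snd q) (?Y \<omega>))\<^sup>2)))"
        using s0 A by (intro exp_sum_le) auto
      then show "exp (\<Sum>(k, i)\<in>?I. s0 * A * (pre d (u k) i (?Y \<omega>))\<^sup>2) \<le>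
        1 + (\<Sum>(k, i)\<in>?I. exp (a * (pre d (u k) i (?Y \<omega>))\<^sup>2))"
        unfolding a_def case_prod_beta by (simp only: mult.assoc)
    qed simp
    finally have "ennreal (exp (s0 * \<bar>X \<omega>\<bar>)) \<le>
      ennreal (exp (s0 * A) * (1 + (\<Sum>(k, i)\<in>?I. exp (a * (pre d (u k) i (?Y \<omega>))\<^sup>2))))"
      by (rule ennreal_leI)
    also have "\<dots> = ennreal (exp (s0 * A)) *
        (1 + (\<Sum>(k, i)\<in>?I. ennreal (exp (a * (pre d (u k) i (?Y \<omega>))\<^sup>2))))"
      unfolding case_prod_beta by (simp add: ennreal_mult sum_nonneg ennreal_plus sum_ennreal)
    finally show "ennreal (exp (s0 * \<bar>X \<omega>\<bar>)) \<le> \<dots>" .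
  qed
  also have "\<dots> = ennreal (exp (s0 * A)) * (1 + (\<Sum>(k, i)\<in>?I.
      \<integral>\<^sup>+\<omega>. ennreal (exp (a * (pre d (u k) i (?Y \<omega>))\<^sup>2)) \<partial>point_law d lam))"
    unfolding case_prod_beta
    by (subst nn_integral_cmult, measurable, subst nn_integral_add, measurable,
        subst nn_integral_sum) (simp_all add: emeasure_space_1)
  also have "\<dots> \<le> ennreal (exp (s0 * A)) * (1 + (\<Sum>(k, i)\<in>?I. ennreal (exp (1/4) * sqrt 2)))"
  proof (intro mult_left_mono add_left_mono sum_mono)
    fix q assume "q \<in> ?I"
    then obtain k i where q: "q = (k, i)" "k < 3" "i < K" by auto
    show "(case q of (k, i) \<Rightarrow> \<integral>\<^sup>+\<omega>. ennreal (exp (a * (pre d (u k) i (?Y \<omega>))\<^sup>2)) \<partial>point_law d lam)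
      \<le> (case q of (k, i) \<Rightarrow> ennreal (exp (1/4) * sqrt 2))"
      unfolding q(1) prod.case pre_def by (intro point_law_exp_square_le lam o a u q)
  qed simp
  also have "\<dots> = ennreal (exp (s0 * A) * (1 + 3 * real K * (exp (1/4) * sqrt 2)))"
  proof -
    have "(\<Sum>(k, i)\<in>?I. ennreal (exp (1/4) * sqrt 2)) = ennreal (3 * real K * (exp (1/4) * sqrt 2))"
      by (simp add: card_cartesian_product ennreal_of_nat_eq_real_of_nat ennreal_mult case_prod_beta)
    then show ?thesis by (simp add: ennreal_mult ennreal_plus flip: ennreal_1)
  qed
  finally show ?thesis .
qed

section \<open>Domination of the forms by the envelope\<close>

lemma abs_resid_le:
  assumes "0 \<le> fst p" "fst p \<le> 1"
  shows "\<bar>resid K d \<theta> p\<bar> \<le> 1"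
proof -
  have "0 \<le> sigmoid z" "sigmoid z \<le> 1" for z
    by (simp_all add: sigmoid_def divide_le_eq_1 add_pos_pos add_nonneg_nonneg)
  from this[of "net K d \<theta> (snd p)"] show ?thesis using assms by (auto simp: resid_def abs_le_iff)
qed

context
  fixes K d :: nat and L :: real and \<theta> x y :: "nat + nat \<times> nat \<Rightarrow> real"
  assumes L: "0 < L" and \<theta>: "par_norm K d \<theta> \<le> L"
    and x: "(\<Sum>a\<in>par_idx K d. (x a)\<^sup>2) \<le> 1" and y: "(\<Sum>a\<in>par_idx K d. (y a)\<^sup>2) \<le> 1"
begin

lemma scaled_par_unit: "(\<Sum>a\<in>par_idx K d. (\<theta> a / L)\<^sup>2) \<le> 1"
proof -
  have "(\<Sum>a\<in>par_idx K d. (\<theta> a)\<^sup>2) \<le> L\<^sup>2"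
    using \<theta> unfolding par_norm_def by (rule sqrt_le_D)
  then show ?thesis using L by (simp add: power_divide sum_divide_distrib[symmetric])
qed

lemma triple_rows_unit:
  assumes "i < K"
  shows "(\<Sum>j<d. (triple (\<lambda>a. \<theta> a / L) x y k (Inr (i, j)))\<^sup>2) \<le> 1"
  using par_idx_row_sq_le[OF x assms] par_idx_row_sq_le[OF y assms]
    par_idx_row_sq_le[OF scaled_par_unit assms] by (simp add: triple_def)

text \<open>In each unit the outer test entry is at most 1 and the outer weight at most
  \<open>L\<close> in absolute value, and the preactivation is \<open>L\<close> times a projection
  onto a vector of norm at most 1. The factor 2 comes from squaring a sum of two terms,
  \<open>K\<close> from Cauchy-Schwarz over the units.\<close>

lemma net_grad_form_sq_le:
  assumes z: "(\<Sum>a\<in>par_idx K d. (z a)\<^sup>2) \<le> 1"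
  shows "(\<Sum>a\<in>par_idx K d. z a * net_grad (\<lambda>_. 0) d \<theta> Y a)\<^sup>2 \<le>
    2 * real K * L\<^sup>2 * ((\<Sum>i<K. (pre d (\<lambda>a. \<theta> a / L) i Y)\<^sup>2) + (\<Sum>i<K. (pre d z i Y)\<^sup>2))"
proof -
  define f where "f = (\<lambda>i. z (Inl i) * relu (pre d \<theta> i Y) + \<theta> (Inl i) * (of_bool (0 < pre d \<theta> i Y) * pre d z i Y))"
  have fi: "(f i)\<^sup>2 \<le> 2 * L\<^sup>2 * ((pre d (\<lambda>a. \<theta> a / L) i Y)\<^sup>2 + (pre d z i Y)\<^sup>2)" if i: "i < K" for i
  proof -
    have mem: "Inl i \<in> par_idx K d" using i by (simp add: par_idx_def)
    have pL: "pre d \<theta> i Y = L * pre d (\<lambda>a. \<theta> a / L) i Y"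
      using L by (simp add: pre_def sum_distrib_left)
    have "(z (Inl i) * relu (pre d \<theta> i Y))\<^sup>2 \<le> 1 * (pre d \<theta> i Y)\<^sup>2"
      unfolding power_mult_distrib
      by (intro mult_mono par_idx_entry_sq_le[OF z mem]) (auto simp: relu_def max_def)
    then have t1: "(z (Inl i) * relu (pre d \<theta> i Y))\<^sup>2 \<le> L\<^sup>2 * (pre d (\<lambda>a. \<theta> a / L) i Y)\<^sup>2"
      unfolding pL by (simp add: power_mult_distrib)
    have "(\<theta> (Inl i) / L)\<^sup>2 \<le> 1" by (rule par_idx_entry_sq_le[OF scaled_par_unit mem])
    then have "(\<theta> (Inl i))\<^sup>2 \<le> L\<^sup>2" using L by (simp add: power_divide)
    then have t2: "(\<theta> (Inl i) * (of_bool (0 < pre d \<theta> i Y) * pre d z i Y))\<^sup>2 \<le> L\<^sup>2 * (pre d z i Y)\<^sup>2"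
      unfolding power_mult_distrib by (intro mult_mono) auto
    have "(f i)\<^sup>2 \<le> 2 * (z (Inl i) * relu (pre d \<theta> i Y))\<^sup>2
        + 2 * (\<theta> (Inl i) * (of_bool (0 < pre d \<theta> i Y) * pre d z i Y))\<^sup>2"
      unfolding f_def power2_sum
      using sum_squares_bound[of "z (Inl i) * relu (pre d \<theta> i Y)"
          "\<theta> (Inl i) * (of_bool (0 < pre d \<theta> i Y) * pre d z i Y)"] by linarith
    with t1 t2 show ?thesis by (simp add: distrib_left)
  qed
  have "(\<Sum>a\<in>par_idx K d. z a * net_grad (\<lambda>_. 0) d \<theta> Y a)\<^sup>2 = (\<Sum>i<K. 1 * f i)\<^sup>2"
    by (simp add: net_grad_form f_def)
  also have "\<dots> \<le> (\<Sum>i<K. 1\<^sup>2) * (\<Sum>i<K. (f i)\<^sup>2)" by (rule Cauchy_Schwarz_ineq_sum)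
  also have "\<dots> \<le> real K * (\<Sum>i<K. 2 * L\<^sup>2 * ((pre d (\<lambda>a. \<theta> a / L) i Y)\<^sup>2 + (pre d z i Y)\<^sup>2))"
    using fi by (auto intro!: mult_left_mono sum_mono)
  also have "\<dots> = 2 * real K * L\<^sup>2 * ((\<Sum>i<K. (pre d (\<lambda>a. \<theta> a / L) i Y)\<^sup>2) + (\<Sum>i<K. (pre d z i Y)\<^sup>2))"
    by (simp add: sum_distrib_left[symmetric] sum.distrib)
  finally show ?thesis .
qed

text \<open>By 2 |f g| <= f^2 + g^2 the rows of the parameter are counted twice and those of
  \<open>x\<close> and \<open>y\<close> once, so twice the envelope dominates.\<close>

lemma net_grad_form_prod_le:
  "\<bar>(\<Sum>a\<in>par_idx K d. x a * net_grad (\<lambda>_. 0) d \<theta> Y a) * (\<Sum>a\<in>par_idx K d. y a * net_grad (\<lambda>_. 0) d \<theta> Y a)\<bar>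
    \<le> 2 * real K * L\<^sup>2 * envelope K d (triple (\<lambda>a. \<theta> a / L) x y) Y"
proof -
  define f where "f = (\<Sum>a\<in>par_idx K d. x a * net_grad (\<lambda>_. 0) d \<theta> Y a)"
  define g where "g = (\<Sum>a\<in>par_idx K d. y a * net_grad (\<lambda>_. 0) d \<theta> Y a)"
  have "2 * \<bar>f * g\<bar> \<le> f\<^sup>2 + g\<^sup>2"
    using sum_squares_bound[of "\<bar>f\<bar>" "\<bar>g\<bar>"] by (simp add: abs_mult)
  also have "\<dots> \<le> 2 * real K * L\<^sup>2 * ((\<Sum>i<K. (pre d (\<lambda>a. \<theta> a / L) i Y)\<^sup>2) + (\<Sum>i<K. (pre d x i Y)\<^sup>2))
      + 2 * real K * L\<^sup>2 * ((\<Sum>i<K. (pre d (\<lambda>a. \<theta> a / L) i Y)\<^sup>2) + (\<Sum>i<K. (pre d y i Y)\<^sup>2))"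
    unfolding f_def g_def by (intro add_mono net_grad_form_sq_le x y)
  also have "\<dots> \<le> 2 * (2 * real K * L\<^sup>2 * envelope K d (triple (\<lambda>a. \<theta> a / L) x y) Y)"
  proof -
    have "0 \<le> 2 * real K * L\<^sup>2 * ((\<Sum>i<K. (pre d x i Y)\<^sup>2) + (\<Sum>i<K. (pre d y i Y)\<^sup>2))"
      by (intro mult_nonneg_nonneg add_nonneg_nonneg sum_nonneg) auto
    then show ?thesis unfolding envelope_triple by (simp add: algebra_simps)
  qed
  finally show ?thesis unfolding f_def g_def by simp
qed

lemma net_hess_form_le:
  "\<bar>\<Sum>a\<in>par_idx K d. \<Sum>b\<in>par_idx K d. x a * net_hess d \<theta> Y a b * y b\<bar>
    \<le> real K + envelope K d (triple (\<lambda>a. \<theta> a / L) x y) Y"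
proof -
  \<comment> \<open>Each unit contributes two products of a bounded entry with a projection. The two
    constants 1/2 add up to 1 per unit, hence \<open>real K\<close> in the bound.\<close>
  have bd: "\<bar>w * v\<bar> \<le> 1/2 + v\<^sup>2" if "w\<^sup>2 \<le> 1" for w v :: real
  proof -
    have "2 * \<bar>w * v\<bar> \<le> w\<^sup>2 + v\<^sup>2"
      using sum_squares_bound[of "\<bar>w\<bar>" "\<bar>v\<bar>"] by (simp add: abs_mult)
    then show ?thesis using that zero_le_power2[of v] by linarith
  qed
  have "\<bar>\<Sum>a\<in>par_idx K d. \<Sum>b\<in>par_idx K d. x a * net_hess d \<theta> Y a b * y b\<bar> \<le>
    (\<Sum>i<K. \<bar>of_bool (0 < pre d \<theta> i Y) * (x (Inl i) * pre d y i Y + y (Inl i) * pre d x i Y)\<bar>)"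
    unfolding net_hess_form by (rule sum_abs)
  also have "\<dots> \<le> (\<Sum>i<K. 1 + (pre d x i Y)\<^sup>2 + (pre d y i Y)\<^sup>2)"
  proof (rule sum_mono)
    fix i assume "i \<in> {..<K}"
    then have mem: "Inl i \<in> par_idx K d" by (simp add: par_idx_def)
    have "\<bar>of_bool (0 < pre d \<theta> i Y) * (x (Inl i) * pre d y i Y + y (Inl i) * pre d x i Y)\<bar>
      \<le> \<bar>x (Inl i) * pre d y i Y\<bar> + \<bar>y (Inl i) * pre d x i Y\<bar>"
      by (cases "0 < pre d \<theta> i Y") (simp_all add: abs_triangle_ineq)
    then show "\<bar>of_bool (0 < pre d \<theta> i Y) * (x (Inl i) * pre d y i Y + y (Inl i) * pre d x i Y)\<bar>
      \<le> 1 + (pre d x i Y)\<^sup>2 + (pre d y i Y)\<^sup>2"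
      using bd[OF par_idx_entry_sq_le[OF x mem], of "pre d y i Y"]
        bd[OF par_idx_entry_sq_le[OF y mem], of "pre d x i Y"] by linarith
  qed
  also have "\<dots> \<le> real K + envelope K d (triple (\<lambda>a. \<theta> a / L) x y) Y"
    unfolding envelope_triple by (simp add: sum.distrib sum_nonneg)
  finally show ?thesis .
qed

lemma envelope_nonneg: "0 \<le> envelope K d u Y"
  unfolding envelope_def by (auto intro: sum_nonneg)

text \<open>Both scalar factors, the derivative of \<open>sigmoid\<close> and the residual, are at
  most 1 in absolute value, which leaves the two network bounds. The constant also dominates the
  gradient form below, so that one exponential moment serves both matrices.\<close>

lemma loss_hess_form_le:
  assumes "0 \<le> fst p" "fst p \<le> 1"
  shows "\<bar>\<Sum>a\<in>par_idx K d. \<Sum>b\<in>par_idx K d. x a * loss_hess K d \<theta> p a b * y b\<bar>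
    \<le> (2 * real K * L\<^sup>2 + real K + 1) * (1 + envelope K d (triple (\<lambda>a. \<theta> a / L) x y) (snd p))"
proof -
  define E where "E = envelope K d (triple (\<lambda>a. \<theta> a / L) x y) (snd p)"
  define c where "c = exp (net K d \<theta> (snd p)) / (1 + exp (net K d \<theta> (snd p)))\<^sup>2"
  define f where "f = (\<Sum>a\<in>par_idx K d. x a * net_grad (\<lambda>_. 0) d \<theta> (snd p) a)"
  define g where "g = (\<Sum>a\<in>par_idx K d. y a * net_grad (\<lambda>_. 0) d \<theta> (snd p) a)"
  define h where "h = (\<Sum>a\<in>par_idx K d. \<Sum>b\<in>par_idx K d. x a * net_hess d \<theta> (snd p) a b * y b)"
  have E: "0 \<le> E" unfolding E_def by (rule envelope_nonneg)
  have c: "\<bar>c\<bar> \<le> 1"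
  proof -
    have "exp z / (1 + exp z)\<^sup>2 \<le> 1" for z :: real
    proof -
      have "0 < 1 + exp z" by (simp add: add_pos_pos)
      moreover have "exp z \<le> (1 + exp z)\<^sup>2" by (simp add: power2_eq_square algebra_simps add_nonneg_nonneg)
      ultimately show ?thesis by simp
    qed
    then show ?thesis unfolding c_def by simp
  qed
  have "(\<Sum>a\<in>par_idx K d. \<Sum>b\<in>par_idx K d. x a * loss_hess K d \<theta> p a b * y b) = c * (f * g) + resid K d \<theta> p * h"
    unfolding f_def g_def h_def loss_hess_def c_def[symmetric] sum_product
    by (simp add: sum_distrib_left sum.distrib[symmetric] algebra_simps)
  also have "\<bar>\<dots>\<bar> \<le> \<bar>c\<bar> * \<bar>f * g\<bar> + \<bar>resid K d \<theta> p\<bar> * \<bar>h\<bar>"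
    by (metis abs_mult abs_triangle_ineq)
  also have "\<dots> \<le> 1 * (2 * real K * L\<^sup>2 * E) + 1 * (real K + E)"
    unfolding E_def f_def g_def h_def
    by (intro add_mono mult_mono c abs_resid_le assms net_grad_form_prod_le net_hess_form_le) auto
  also have "\<dots> \<le> (2 * real K * L\<^sup>2 + real K + 1) * (1 + E)"
    using E by (simp add: algebra_simps)
  finally show ?thesis unfolding E_def .
qed

lemma loss_grad_form_le:
  assumes "0 \<le> fst p" "fst p \<le> 1"
  shows "\<bar>\<Sum>a\<in>par_idx K d. \<Sum>b\<in>par_idx K d. x a * ((resid K d \<theta> p * net_grad (\<lambda>_. 0) d \<theta> (snd p) a) *
      (resid K d \<theta> p * net_grad (\<lambda>_. 0) d \<theta> (snd p) b)) * y b\<bar>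
    \<le> (2 * real K * L\<^sup>2 + real K + 1) * (1 + envelope K d (triple (\<lambda>a. \<theta> a / L) x y) (snd p))"
proof -
  define E where "E = envelope K d (triple (\<lambda>a. \<theta> a / L) x y) (snd p)"
  define r where "r = resid K d \<theta> p"
  define f where "f = (\<Sum>a\<in>par_idx K d. x a * net_grad (\<lambda>_. 0) d \<theta> (snd p) a)"
  define g where "g = (\<Sum>a\<in>par_idx K d. y a * net_grad (\<lambda>_. 0) d \<theta> (snd p) a)"
  have E: "0 \<le> E" unfolding E_def by (rule envelope_nonneg)
  have r: "\<bar>r\<^sup>2\<bar> \<le> 1" unfolding r_def using abs_resid_le[OF assms, of K d \<theta>] by (simp add: abs_square_le_1)
  have "(\<Sum>a\<in>par_idx K d. \<Sum>b\<in>par_idx K d. x a * ((r * net_grad (\<lambda>_. 0) d \<theta> (snd p) a) *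
      (r * net_grad (\<lambda>_. 0) d \<theta> (snd p) b)) * y b) = r\<^sup>2 * (f * g)"
    unfolding f_def g_def sum_product
    by (simp add: sum_distrib_left power2_eq_square mult_ac)
  also have "\<bar>\<dots>\<bar> = \<bar>r\<^sup>2\<bar> * \<bar>f * g\<bar>" by (rule abs_mult)
  also have "\<dots> \<le> 1 * (2 * real K * L\<^sup>2 * E)"
    unfolding E_def f_def g_def by (intro mult_mono r net_grad_form_prod_le) auto
  also have "\<dots> \<le> (2 * real K * L\<^sup>2 + real K + 1) * (1 + E)"
    using E by (simp add: algebra_simps)
  finally show ?thesis unfolding E_def r_def .
qed

end

section \<open>Dimension count and conclusion\<close>

text \<open>The number of pairs of net points is absorbed into the exponent: for d >= 1, 2 (K + K d)
  <= 4 K d, which is the origin of \<open>4 * real K * ln (3 * 2 ^ 16)\<close> as the constant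
  C.\<close>

lemma net_size_le_exp:
  assumes "0 < d"
  shows "(3 * 2 ^ 16) ^ (2 * card (par_idx K d)) * exp (- (c * real n * w))
    \<le> exp (- (c * (real n / real d) * w - 4 * real K * ln (3 * 2 ^ 16)) * real d)"
proof -
  define q :: real where "q = 3 * 2 ^ 16"
  have q: "1 \<le> q" by (simp add: q_def)
  have "q ^ (2 * card (par_idx K d)) = exp (real (2 * card (par_idx K d)) * ln q)"
    unfolding exp_of_nat_mult using q by simp
  also have "\<dots> \<le> exp (real (4 * K * d) * ln q)"
  proof -
    have "2 * card (par_idx K d) \<le> 4 * K * d" using assms by (simp add: card_par_idx)
    then have "real (2 * card (par_idx K d)) \<le> real (4 * K * d)" by (rule of_nat_mono)
    then show ?thesis using q by (simp add: mult_right_mono del: of_nat_mult)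
  qed
  finally have "q ^ (2 * card (par_idx K d)) * exp (- (c * real n * w))
      \<le> exp (real (4 * K * d) * ln q) * exp (- (c * real n * w))"
    by (rule mult_right_mono) simp
  also have "\<dots> = exp (- (c * (real n / real d) * w - 4 * real K * ln q) * real d)"
    unfolding exp_add[symmetric] using assms by (simp add: field_simps)
  finally show ?thesis unfolding q_def .
qed

lemma emp_hess_eq_hess_risk:
  "emp_hess K d M \<mu> \<nu> \<omega> \<theta> = hess (risk K d M (\<lambda>l. data_point d \<mu> \<nu> (\<omega> l))) \<theta>"
  unfolding emp_hess_def emp_risk_def risk_def ..

lemma measurable_sample_data_point:
  assumes "l < M"
  shows "(\<lambda>\<omega>. fst (data_point d \<mu> \<nu> (\<omega> l))) \<in> borel_measurable (sample_space d M lam)"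
    and "j < d \<Longrightarrow> (\<lambda>\<omega>. snd (data_point d \<mu> \<nu> (\<omega> l)) j) \<in> borel_measurable (sample_space d M lam)"
proof -
  have [measurable]: "(\<lambda>\<omega>. \<omega> l) \<in> measurable (sample_space d M lam) (point_law d lam)"
    unfolding sample_space_def using assms by (intro measurable_component_singleton) simp
  show "(\<lambda>\<omega>. fst (data_point d \<mu> \<nu> (\<omega> l))) \<in> borel_measurable (sample_space d M lam)"
    by measurable
  show "(\<lambda>\<omega>. snd (data_point d \<mu> \<nu> (\<omega> l)) j) \<in> borel_measurable (sample_space d M lam)" if "j < d"
    using that by measurable
qed

lemma AE_sample_pre_nonzero:
  assumes lam: "0 < lam" and \<theta>: "rows_nonzero K d \<theta>"
  shows "AE \<omega> in sample_space d M lam. \<forall>l<M. \<forall>i<K. pre d \<theta> i (snd (data_point d \<mu> \<nu> (\<omega> l))) \<noteq> 0"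
proof -
  have "AE \<omega> in sample_space d M lam. pre d \<theta> i (snd (data_point d \<mu> \<nu> (\<omega> l))) \<noteq> 0"
    if "l < M" "i < K" for l i
    unfolding sample_space_def pre_def using \<theta> that lam
    by (intro AE_PiM_component AE_point_law_linear_neq prob_space_point_law)
      (auto simp: rows_nonzero_def)
  then have "AE \<omega> in sample_space d M lam. \<forall>l\<in>{..<M}. \<forall>i\<in>{..<K}.
      pre d \<theta> i (snd (data_point d \<mu> \<nu> (\<omega> l))) \<noteq> 0"
    by (intro AE_finite_allI) auto
  then show ?thesis by eventually_elim auto
qed

text \<open>Outer measure agrees with the probability on measurable events. \<open>c\<close> depends
  on \<open>K\<close> and \<open>L\<close> through the envelope constant, whereas the
  \<open>C\<close> chosen below comes from the net alone and involves only \<open>K\<close>.\<close>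

theorem theorem6p2:
  fixes K :: nat and L :: real
  assumes "L > 0"
  shows "\<exists>c>0. \<exists>C::real. \<forall>(d::nat) (M::nat) (lam::real) \<mu> \<nu> (t::real).
     orthonormal2 d \<mu> \<nu> \<longrightarrow> M \<ge> 1 \<longrightarrow> lam \<ge> 1 \<longrightarrow> t > 0 \<longrightarrow>
     (let \<alpha> = real M / real d;
          \<Omega> = sample_space d M lam;
          P = par_idx K d;
          bound = ennreal (exp (- (c * \<alpha> * min t (t\<^sup>2) - C) * real d))
      in (\<forall>\<theta>. par_norm K d \<theta> \<le> L \<longrightarrow> rows_nonzero K d \<theta> \<longrightarrow>
            outer_measure_of \<Omega>
              {\<omega> \<in> space \<Omega>. op_norm P (\<lambda>a b. emp_hess K d M \<mu> \<nu> \<omega> \<theta> a b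
                 - (\<integral>\<omega>'. emp_hess K d M \<mu> \<nu> \<omega>' \<theta> a b \<partial>\<Omega>)) > t} \<le> bound)
       \<and> (\<forall>\<theta>. par_norm K d \<theta> \<le> L \<longrightarrow>
            outer_measure_of \<Omega>
              {\<omega> \<in> space \<Omega>. op_norm P (\<lambda>a b. emp_G K d M \<mu> \<nu> \<omega> \<theta> a b
                 - (\<integral>\<omega>'. emp_G K d M \<mu> \<nu> \<omega>' \<theta> a b \<partial>\<Omega>)) > t} \<le> bound))"
proof -
  \<comment> \<open>\<open>A\<close> is the envelope constant of both forms, \<open>s0\<close> and
    \<open>B\<close> are the exponent and bound of the resulting moment, and \<open>c\<close> is the
    Bernstein constant with the final division by 4 due to the level t/2.\<close>
  define A where "A = 2 * real K * L\<^sup>2 + real K + 1"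
  define s0 where "s0 = 1 / (8 * A * (3 * real K + 1))"
  define B where "B = exp (s0 * A) * (1 + 3 * real K * (exp (1/4) * sqrt 2))"
  define c where "c = min (s0\<^sup>2 / (16 * B * exp B)) (s0 / 4) / 4"
  have A: "0 < A" by (simp add: A_def add_nonneg_pos)
  then have s0: "0 < s0" by (simp add: s0_def add_nonneg_pos)
  have B: "0 < B" by (simp add: B_def add_pos_nonneg)
  have c: "0 < c" using s0 B by (simp add: c_def)
  \<comment> \<open>Common core of both bounds: \<open>F\<close> is the matrix defined through
    \<open>pd\<close>, \<open>H\<close> its explicit one-point formula. Almost sure agreement is the
    form that also accommodates the Hessian.\<close>
  have tail: "outer_measure_of (sample_space d M lam) {\<omega> \<in> space (sample_space d M lam).
      op_norm (par_idx K d) (\<lambda>a b. F \<omega> a b - (\<integral>\<omega>'. F \<omega>' a b \<partial>sample_space d M lam)) > t}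
    \<le> ennreal (exp (- (c * (real M / real d) * min t (t\<^sup>2) - 4 * real K * ln (3 * 2 ^ 16)) * real d))"
    if o: "orthonormal2 d \<mu> \<nu>" and M: "M \<ge> 1" and lam: "lam \<ge> 1" and t: "t > 0"
      and \<theta>: "par_norm K d \<theta> \<le> L"
      and H: "\<And>a b. a \<in> par_idx K d \<Longrightarrow> b \<in> par_idx K d \<Longrightarrow>
        (\<lambda>\<omega>. H (data_point d \<mu> \<nu> \<omega>) a b) \<in> borel_measurable (point_law d lam)"
      and F: "\<And>a b. a \<in> par_idx K d \<Longrightarrow> b \<in> par_idx K d \<Longrightarrow>
        (\<lambda>\<omega>. F \<omega> a b) \<in> borel_measurable (sample_space d M lam)"
      and eq: "AE \<omega> in sample_space d M lam. \<forall>a\<in>par_idx K d. \<forall>b\<in>par_idx K d.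
        F \<omega> a b = (\<Sum>l<M. H (data_point d \<mu> \<nu> (\<omega> l)) a b) / real M"
      and form: "\<And>x y p. (\<Sum>a\<in>par_idx K d. (x a)\<^sup>2) \<le> 1 \<Longrightarrow> (\<Sum>a\<in>par_idx K d. (y a)\<^sup>2) \<le> 1 \<Longrightarrow>
        0 \<le> fst p \<Longrightarrow> fst p \<le> 1 \<Longrightarrow>
        \<bar>\<Sum>a\<in>par_idx K d. \<Sum>b\<in>par_idx K d. x a * H p a b * y b\<bar>
          \<le> (2 * real K * L\<^sup>2 + real K + 1) * (1 + envelope K d (triple (\<lambda>a. \<theta> a / L) x y) (snd p))"
    for d M :: nat and lam t :: real and \<mu> \<nu> :: "nat \<Rightarrow> real" and \<theta>
      and H :: "real \<times> (nat \<Rightarrow> real) \<Rightarrow> nat + nat \<times> nat \<Rightarrow> nat + nat \<times> nat \<Rightarrow> real"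
      and F
  proof -
    interpret prob_space "point_law d lam" using lam by (intro prob_space_point_law) simp
    \<comment> \<open>In dimension 0 the squared norm of \<open>\<mu>\<close> would be an empty sum,
      not 1.\<close>
    have d: "0 < d" using o by (cases d) (auto simp: orthonormal2_def)
    have lab: "0 \<le> fst (data_point d \<mu> \<nu> \<omega>)" "fst (data_point d \<mu> \<nu> \<omega>) \<le> 1" for \<omega>
      by (auto simp: data_point_def split: prod.split)
    have mom: "(\<integral>\<^sup>+\<omega>. ennreal (exp (s0 * \<bar>\<Sum>a\<in>par_idx K d. \<Sum>b\<in>par_idx K d.
        x a * H (data_point d \<mu> \<nu> \<omega>) a b * y b\<bar>)) \<partial>point_law d lam) \<le> ennreal B"
      if x: "(\<Sum>a\<in>par_idx K d. (x a)\<^sup>2) \<le> 1" and y: "(\<Sum>a\<in>par_idx K d. (y a)\<^sup>2) \<le> 1" for x y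
      unfolding s0_def B_def
      by (rule exp_moment_envelope[OF lam o A, where u = "triple (\<lambda>a. \<theta> a / L) x y"])
        (use triple_rows_unit[OF assms \<theta> x y] form[OF x y lab] in \<open>auto simp: A_def\<close>)
    have "outer_measure_of (sample_space d M lam) {\<omega> \<in> space (sample_space d M lam).
        op_norm (par_idx K d) (\<lambda>a b. F \<omega> a b - (\<integral>\<omega>'. F \<omega>' a b \<partial>sample_space d M lam)) > t}
      \<le> ennreal ((3 * 2 ^ 16) ^ (2 * card (par_idx K d)) * exp (- (c * real M * min t (t\<^sup>2))))"
      unfolding sample_space_def c_def
      using iid_matrix_mean_tail_AE[OF finite_par_idx s0 B t _ H mom
          F[unfolded sample_space_def] eq[unfolded sample_space_def]] M by simp
    also have "\<dots> \<le> ennreal (exp (- (c * (real M / real d) * min t (t\<^sup>2)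
        - 4 * real K * ln (3 * 2 ^ 16)) * real d))"
      by (intro ennreal_leI net_size_le_exp d)
    finally show ?thesis .
  qed
  show ?thesis unfolding Let_def
  proof (rule exI[of _ c], rule conjI[OF c], rule exI[of _ "4 * real K * ln (3 * 2 ^ 16)"],
      intro allI impI conjI)
    fix d M :: nat and lam t :: real and \<mu> \<nu> :: "nat \<Rightarrow> real" and \<theta>
    assume hyp: "orthonormal2 d \<mu> \<nu>" "1 \<le> M" "1 \<le> lam" "0 < t" and \<theta>: "par_norm K d \<theta> \<le> L"
    have meas: "(\<lambda>\<omega>. loss_hess K d \<theta> (data_point d \<mu> \<nu> \<omega>) a b) \<in> borel_measurable (point_law d lam)"
      "(\<lambda>\<omega>. (resid K d \<theta> (data_point d \<mu> \<nu> \<omega>) * net_grad (\<lambda>_. 0) d \<theta> (snd (data_point d \<mu> \<nu> \<omega>)) a) *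
        (resid K d \<theta> (data_point d \<mu> \<nu> \<omega>) * net_grad (\<lambda>_. 0) d \<theta> (snd (data_point d \<mu> \<nu> \<omega>)) b))
          \<in> borel_measurable (point_law d lam)"
      if "a \<in> par_idx K d" "b \<in> par_idx K d" for a b
      using that by (auto intro!: measurable_loss_hess borel_measurable_times measurable_resid
          measurable_net_grad measurable_data_point)
    show "outer_measure_of (sample_space d M lam) {\<omega> \<in> space (sample_space d M lam).
        t < op_norm (par_idx K d) (\<lambda>a b. emp_hess K d M \<mu> \<nu> \<omega> \<theta> a b
          - (\<integral>\<omega>'. emp_hess K d M \<mu> \<nu> \<omega>' \<theta> a b \<partial>sample_space d M lam))}
      \<le> ennreal (exp (- (c * (real M / real d) * min t (t\<^sup>2) - 4 * real K * ln (3 * 2 ^ 16)) * real d))"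
      if nz: "rows_nonzero K d \<theta>"
    proof (rule tail[OF hyp \<theta> meas(1)])
      show "AE \<omega> in sample_space d M lam. \<forall>a\<in>par_idx K d. \<forall>b\<in>par_idx K d.
          emp_hess K d M \<mu> \<nu> \<omega> \<theta> a b = (\<Sum>l<M. loss_hess K d \<theta> (data_point d \<mu> \<nu> (\<omega> l)) a b) / real M"
      proof -
        have "0 < lam" using hyp by simp
        from AE_sample_pre_nonzero[OF this nz] show ?thesis
          by eventually_elim (auto simp: emp_hess_eq_hess_risk intro!: hess_risk_smooth)
      qed
    next
      fix x y :: "nat + nat \<times> nat \<Rightarrow> real" and p :: "real \<times> (nat \<Rightarrow> real)"
      assume "(\<Sum>a\<in>par_idx K d. (x a)\<^sup>2) \<le> 1" "(\<Sum>a\<in>par_idx K d. (y a)\<^sup>2) \<le> 1" "0 \<le> fst p" "fst p \<le> 1"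
      then show "\<bar>\<Sum>a\<in>par_idx K d. \<Sum>b\<in>par_idx K d. x a * loss_hess K d \<theta> p a b * y b\<bar>
          \<le> (2 * real K * L\<^sup>2 + real K + 1) * (1 + envelope K d (triple (\<lambda>a. \<theta> a / L) x y) (snd p))"
        by (rule loss_hess_form_le[OF assms \<theta>])
    qed (auto simp: emp_hess_eq_hess_risk
        intro!: measurable_hess_risk measurable_sample_data_point)
    have G: "emp_G K d M \<mu> \<nu> \<omega> \<theta> a b = (\<Sum>l<M.
        (resid K d \<theta> (data_point d \<mu> \<nu> (\<omega> l)) * net_grad (\<lambda>_. 0) d \<theta> (snd (data_point d \<mu> \<nu> (\<omega> l))) a) *
        (resid K d \<theta> (data_point d \<mu> \<nu> (\<omega> l)) * net_grad (\<lambda>_. 0) d \<theta> (snd (data_point d \<mu> \<nu> (\<omega> l))) b))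
          / real M" if "a \<in> par_idx K d" "b \<in> par_idx K d" for \<omega> a b
      unfolding emp_G_def by (simp add: pd_loss that)
    show "outer_measure_of (sample_space d M lam) {\<omega> \<in> space (sample_space d M lam).
        t < op_norm (par_idx K d) (\<lambda>a b. emp_G K d M \<mu> \<nu> \<omega> \<theta> a b
          - (\<integral>\<omega>'. emp_G K d M \<mu> \<nu> \<omega>' \<theta> a b \<partial>sample_space d M lam))}
      \<le> ennreal (exp (- (c * (real M / real d) * min t (t\<^sup>2) - 4 * real K * ln (3 * 2 ^ 16)) * real d))"
    proof (rule tail[OF hyp \<theta> meas(2)])
      fix a b assume ab: "a \<in> par_idx K d" "b \<in> par_idx K d"
      show "(\<lambda>\<omega>. emp_G K d M \<mu> \<nu> \<omega> \<theta> a b) \<in> borel_measurable (sample_space d M lam)"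
        unfolding G[OF ab]
        by (intro borel_measurable_divide borel_measurable_sum borel_measurable_times measurable_resid
            measurable_net_grad[OF _ _ ab(1)] measurable_net_grad[OF _ _ ab(2)]
            measurable_sample_data_point borel_measurable_const) auto
    next
      fix x y :: "nat + nat \<times> nat \<Rightarrow> real" and p :: "real \<times> (nat \<Rightarrow> real)"
      assume "(\<Sum>a\<in>par_idx K d. (x a)\<^sup>2) \<le> 1" "(\<Sum>a\<in>par_idx K d. (y a)\<^sup>2) \<le> 1" "0 \<le> fst p" "fst p \<le> 1"
      then show "\<bar>\<Sum>a\<in>par_idx K d. \<Sum>b\<in>par_idx K d. x a * ((resid K d \<theta> p * net_grad (\<lambda>_. 0) d \<theta> (snd p) a) *
            (resid K d \<theta> p * net_grad (\<lambda>_. 0) d \<theta> (snd p) b)) * y b\<bar>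
          \<le> (2 * real K * L\<^sup>2 + real K + 1) * (1 + envelope K d (triple (\<lambda>a. \<theta> a / L) x y) (snd p))"
        by (rule loss_grad_form_le[OF assms \<theta>])
    qed (auto simp: G)
  qed
qed

end
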